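(* Let $P:\subseteq\mathbb{N}^{\mathbb{N}}\rightrightarrows\mathbb{N}^{\mathbb{N}}$ be a problem and let $\alpha$ be a countable ordinal. The following are equivalent. 1. There is a set $A\subseteq\mathbb{N}^{\mathbb{N}}$ such that $P|_A$ is discontinuous and each point $p\in A$ has Cantor–Bendixson rank $\mathrm{rank}_A(p)\le\alpha$. 2. $\mathsf{ACC}_{\mathbb{N}}^{\alpha}\le_{\mathrm{W}}^{*}P$.
   Context: **Problems.** $\mathbb{N}^{\mathbb{N}}$ is Baire space with the product topology. A problem $P:\subseteq\mathbb{N}^{\mathbb{N}}\rightrightarrows\mathbb{N}^{\mathbb{N}}$ is a partial multivalued function: a set $\mathrm{dom}(P)\subseteq\mathbb{N}^{\mathbb{N}}$ of instances and, for each $p\in\mathrm{dom}(P)$, a set $P(p)\subseteq\mathbb{N}^{\mathbb{N}}$ of solutions; $P(p)=\emptyset$ is allowed. $P|_A$ has domain $\mathrm{dom}(P)\cap A$ and the same solution sets. $P$ is continuous if there is a continuous partial function $\Phi:\subseteq\mathbb{N}^{\mathbb{N}}\to\mathbb{N}^{\mathbb{N}}$ defined on $\mathrm{dom}(P)$ with $\Phi(p)\in P(p)$ for all $p\in\mathrm{dom}(P)$; otherwise it is discontinuous. **Continuous Weihrauch reducibility.** $P\le_{\mathrm{W}}^{*}Q$ if there are continuous partial functions $\Phi$ (forward) and $\Psi$ (backward) such that for all $p\in\mathrm{dom}(P)$, $\Phi(p)$ is defined and in $\mathrm{dom}(Q)$, and for all $\hat q\in Q(\Phi(p))$, $\Psi(p,\hat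 q)$ is defined and in $P(p)$. **Rank.** For $p\in A\subseteq\mathbb{N}^{\mathbb{N}}$, $\mathrm{rank}_A(p)$ is the Cantor–Bendixson rank: the ordinal $\alpha$ with $p\in A^{(\alpha)}\setminus A^{(\alpha+1)}$, where $A^{(\alpha)}$ is the $\alpha$-th iterated Cantor–Bendixson derivative of $A$ (isolated points have rank $0$); it is $\infty$ if there is no such $\alpha$. **$\mathsf{ACC}_{\mathbb{N}}^{\alpha}$.** For $\beta>0$, $\ell_\beta:\mathbb{N}\to\beta$ is rank-witnessing for $\beta$ if it is nondecreasing and for each $\gamma<\beta$ there is $i$ with $\ell_\beta(i)\ge\gamma$. A rank-witnessing representation of $\alpha$ is a family $\{\ell_\beta:0<\beta\le\alpha\}$ with each $\ell_\beta$ rank-witnessing for $\beta$. Fix one. Let $\#$ be an extra symbol and identify $(\mathbb{N}\cup\{\#\})^{\mathbb{N}}$ with $\mathbb{N}^{\mathbb{N}}$ via $\#\mapsto0$, $n\mapsto n+1$. Define recursively $\mathsf{ACC}_{\mathbb{N}}^{\alpha}:\subseteq(\mathbb{N}\cup\{\#\})^{\mathbb{N}}\rightrightarrows(\mathbb{N}\cup\{\#\})^{\mathbb{N}}$: - $\mathrm{dom}(\mathsf{ACC}_{\mathbb{N}}^{0})=\{\#^{\mathbb{N}}\}$ and $\mathsf{ACC}_{\mathbb{N}}^{0}(\#^{\mathbb{N}})=\emptyset$. - For $\alpha>0$: $\mathrm{dom}(\mathsf{ACC}_{\mathbb{N}}^{\alpha})=\{\#^{\mathbb{N}}\}\cup\{\#^{j}nw: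 j,n\in\mathbb{N},\ w\in\mathrm{dom}(\mathsf{ACC}_{\mathbb{N}}^{\ell_\alpha(j)})\}$; $\mathsf{ACC}_{\mathbb{N}}^{\alpha}(\#^{\mathbb{N}})=\{mq:m\in\mathbb{N},q\in(\mathbb{N}\cup\{\#\})^{\mathbb{N}}\}$; and $\mathsf{ACC}_{\mathbb{N}}^{\alpha}(\#^{j}nw)=\{mq:m\in\mathbb{N},m\ne n,q\in(\mathbb{N}\cup\{\#\})^{\mathbb{N}}\}\cup\{n\#^{k}y:k\in\mathbb{N},y\in\mathsf{ACC}_{\mathbb{N}}^{\ell_\alpha(j)}(w)\}$. *)

theory Defs
  imports "HOL-Analysis.Analysis" "HOL-Library.Omega_Words_Fun"
begin

text \<open>
  Baire space is the type of functions from \<open>nat\<close> to \<open>nat\<close> with the library's product topology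
  (\<open>nat\<close> is discrete). A problem is a partial map to solution sets: \<^term>\<open>P p = None\<close> means that
  \<open>p\<close> is not an instance, \<^term>\<open>P p = Some {}\<close> that \<open>p\<close> is an instance without solutions. Then
  \<^term>\<open>dom P\<close> is the set of instances and \<^term>\<open>P |` A\<close> is the restriction to \<open>A\<close>.
\<close>

type_synonym baire = "nat \<Rightarrow> nat"
type_synonym problem = "baire \<rightharpoonup> baire set"

text \<open>
  A continuous partial function is a total function \<open>\<Phi>\<close> together with a domain \<open>D\<close> on which it is
  continuous; values outside \<open>D\<close> are irrelevant.
\<close>

definition continuous_problem :: "problem \<Rightarrow> bool" where
  "continuous_problem P \<longleftrightarrow>
     (\<exists>D (\<Phi> :: baire \<Rightarrow> baire). continuous_on D \<Phi> \<and>
        (\<forall>p \<in> dom P. p \<in> D \<and> \<Phi> p \<in> the (P p)))"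

definition cont_weihrauch_le :: "problem \<Rightarrow> problem \<Rightarrow> bool" (infix \<open>\<le>\<^sub>W\<close> 50) where
  "P \<le>\<^sub>W Q \<longleftrightarrow>
     (\<exists>D (\<Phi> :: baire \<Rightarrow> baire) E (\<Psi> :: baire \<times> baire \<Rightarrow> baire).
        continuous_on D \<Phi> \<and> continuous_on E \<Psi> \<and>
        (\<forall>p \<in> dom P. p \<in> D \<and> \<Phi> p \<in> dom Q \<and>
           (\<forall>q \<in> the (Q (\<Phi> p)). (p, q) \<in> E \<and> \<Psi> (p, q) \<in> the (P p))))"

text \<open>
  Ordinals are elements of a well-ordered type; such an element stands for the order type of the
  set of elements below it. Every ordinal \<open>\<le> \<alpha>\<close> is then again an element \<open>\<beta> \<le> \<alpha>\<close> of the type,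
  but \<open>\<alpha> + 1\<close> need not be, so its derivative is expressed by \<open>derived\<close> below.
\<close>

definition derived :: "'a::topological_space set \<Rightarrow> 'a set" where
  "derived A = {x \<in> A. x islimpt A}"

text \<open>
  One equation covers the zero, successor and limit stages, which are derived from it in
  \<open>cb_derivative_bot\<close>, \<open>cb_derivative_succ\<close> and \<open>cb_derivative_limit\<close>.
\<close>

function cb_derivative :: "'a::topological_space set \<Rightarrow> 'o::wellorder \<Rightarrow> 'a set" where
  "cb_derivative A \<alpha> = A \<inter> (\<Inter>\<beta> \<in> {..<\<alpha>}. derived (cb_derivative A \<beta>))"
  by auto
termination
  by (relation "inv_image {(x, y). x < y} snd") (auto simp: wf)

declare cb_derivative.simps [simp del]

lemma cb_derivative_antimono: "\<beta> \<le> \<alpha> \<Longrightarrow> cb_derivative A \<alpha> \<subseteq> cb_derivative A \<beta>"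
  by (subst (1 2) cb_derivative.simps) force

lemma cb_derivative_bot:
  "cb_derivative A (bot :: 'o::{wellorder, order_bot}) = A"
  by (subst cb_derivative.simps) (auto simp: bot.extremum_strict)

lemma derived_mono: "A \<subseteq> B \<Longrightarrow> derived A \<subseteq> derived B"
  by (auto simp: derived_def intro: islimpt_subset)

lemma cb_derivative_succ:
  assumes "\<beta> < \<alpha>" and "\<And>\<gamma>. \<gamma> < \<alpha> \<Longrightarrow> \<gamma> \<le> \<beta>"
  shows "cb_derivative A \<alpha> = derived (cb_derivative A \<beta>)"
proof -
  have "(\<Inter>\<gamma> \<in> {..<\<alpha>}. derived (cb_derivative A \<gamma>)) = derived (cb_derivative A \<beta>)"
    using assms derived_mono[OF cb_derivative_antimono] by blast
  moreover have "derived (cb_derivative A \<beta>) \<subseteq> A"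
    unfolding derived_def by (subst cb_derivative.simps) auto
  ultimately show ?thesis
    by (subst cb_derivative.simps) auto
qed

lemma cb_derivative_limit:
  fixes \<alpha> :: "'o::wellorder"
  assumes "\<beta>\<^sub>0 < \<alpha>" and "\<And>\<beta>. \<beta> < \<alpha> \<Longrightarrow> \<exists>\<gamma>. \<beta> < \<gamma> \<and> \<gamma> < \<alpha>"
  shows "cb_derivative A \<alpha> = (\<Inter>\<beta> \<in> {..<\<alpha>}. cb_derivative A \<beta>)"
proof
  show "cb_derivative A \<alpha> \<subseteq> (\<Inter>\<beta> \<in> {..<\<alpha>}. cb_derivative A \<beta>)"
    by (intro INT_greatest cb_derivative_antimono) simp
  show "(\<Inter>\<beta> \<in> {..<\<alpha>}. cb_derivative A \<beta>) \<subseteq> cb_derivative A \<alpha>"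
  proof
    fix x
    assume x: "x \<in> (\<Inter>\<beta> \<in> {..<\<alpha>}. cb_derivative A \<beta>)"
    have "x \<in> cb_derivative A \<beta>\<^sub>0"
      using x assms(1) by simp
    then have "x \<in> A"
      by (subst (asm) cb_derivative.simps) simp
    moreover have "x \<in> derived (cb_derivative A \<beta>)" if \<beta>: "\<beta> < \<alpha>" for \<beta>
    proof -
      obtain \<gamma> where "\<beta> < \<gamma>" "\<gamma> < \<alpha>"
        using assms(2)[OF \<beta>] by blast
      then have "x \<in> cb_derivative A \<gamma>"
        using x by simp
      then show ?thesis
        using \<open>\<beta> < \<gamma>\<close> by (subst (asm) cb_derivative.simps) simp
    qed
    ultimately show "x \<in> cb_derivative A \<alpha>"
      by (subst cb_derivative.simps) simp
  qed
qed

text \<open>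
  The rank is a partial function of the point (undefined rank being \<open>\<infinity>\<close>), given by its graph:
  \<open>has_cb_rank A p \<alpha>\<close> says that \<open>p\<close> is in the derivative \<open>\<alpha>\<close> of \<open>A\<close> but not in the next one.
\<close>

definition has_cb_rank :: "'a::topological_space set \<Rightarrow> 'a \<Rightarrow> 'o::wellorder \<Rightarrow> bool" where
  "has_cb_rank A p \<alpha> \<longleftrightarrow> p \<in> cb_derivative A \<alpha> - derived (cb_derivative A \<alpha>)"

lemma has_cb_rank_unique:
  fixes \<alpha> :: "'o::wellorder"
  assumes "has_cb_rank A p \<alpha>" and "has_cb_rank A p \<beta>"
  shows "\<alpha> = \<beta>"
proof -
  have "\<not> \<gamma> < \<delta>" if "has_cb_rank A p \<gamma>" "has_cb_rank A p \<delta>" for \<gamma> \<delta> :: 'o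
  proof
    assume "\<gamma> < \<delta>"
    have "p \<in> cb_derivative A \<delta>"
      using that(2) by (simp add: has_cb_rank_def)
    then have "p \<in> derived (cb_derivative A \<gamma>)"
      using \<open>\<gamma> < \<delta>\<close> by (subst (asm) cb_derivative.simps) simp
    then show False
      using that(1) by (simp add: has_cb_rank_def)
  qed
  then show ?thesis
    using assms by (meson linorder_less_linear)
qed

definition rank_witnessing :: "'o::wellorder \<Rightarrow> (nat \<Rightarrow> 'o) \<Rightarrow> bool" where
  "rank_witnessing \<beta> f \<longleftrightarrow>
     mono f \<and> (\<forall>i. f i < \<beta>) \<and> (\<forall>\<gamma> < \<beta>. \<exists>i. \<gamma> \<le> f i)"

definition rank_witnessing_representation ::
    "'o::{wellorder, order_bot} \<Rightarrow> ('o \<Rightarrow> nat \<Rightarrow> 'o) \<Rightarrow> bool" where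
  "rank_witnessing_representation \<alpha> ell \<longleftrightarrow>
     (\<forall>\<beta>. bot < \<beta> \<and> \<beta> \<le> \<alpha> \<longrightarrow> rank_witnessing \<beta> (ell \<beta>))"

text \<open>
  Sequences over the naturals with an extra symbol \<open>#\<close> are coded in Baire space: \<open>#\<close> is \<open>0\<close> and
  the number \<open>n\<close> is \<open>Suc n\<close>. Concatenation of a finite word with a sequence is \<open>\<frown>\<close>.
\<close>

abbreviation hash :: nat where "hash \<equiv> 0"
abbreviation num :: "nat \<Rightarrow> nat" where "num n \<equiv> Suc n"

abbreviation hashes :: baire where "hashes \<equiv> (\<lambda>_. hash)"

text \<open>
  The recursion on \<open>\<alpha>\<close> is given by inductive definitions, because \<open>ell \<alpha> j < \<alpha>\<close> is known only for
  rank-witnessing families. The recursion equations are proved below.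
\<close>

inductive_set ACC_dom :: "('o::{wellorder, order_bot} \<Rightarrow> nat \<Rightarrow> 'o) \<Rightarrow> ('o \<times> baire) set"
  for ell where
  hashes: "(\<alpha>, hashes) \<in> ACC_dom ell"
| step: "\<lbrakk>bot < \<alpha>; (ell \<alpha> j, w) \<in> ACC_dom ell\<rbrakk> \<Longrightarrow>
    (\<alpha>, (replicate j hash @ [num n]) \<frown> w) \<in> ACC_dom ell"

inductive ACC_sol :: "('o::{wellorder, order_bot} \<Rightarrow> nat \<Rightarrow> 'o) \<Rightarrow> 'o \<Rightarrow> baire \<Rightarrow> baire \<Rightarrow> bool"
  for ell where
  hashes: "bot < \<alpha> \<Longrightarrow> ACC_sol ell \<alpha> hashes ([num m] \<frown> q)"
| avoid: "\<lbrakk>bot < \<alpha>; (ell \<alpha> j, w) \<in> ACC_dom ell; m \<noteq> n\<rbrakk> \<Longrightarrow>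
    ACC_sol ell \<alpha> ((replicate j hash @ [num n]) \<frown> w) ([num m] \<frown> q)"
| step: "\<lbrakk>bot < \<alpha>; (ell \<alpha> j, w) \<in> ACC_dom ell; ACC_sol ell (ell \<alpha> j) w y\<rbrakk> \<Longrightarrow>
    ACC_sol ell \<alpha> ((replicate j hash @ [num n]) \<frown> w) (([num n] @ replicate k hash) \<frown> y)"

definition ACC :: "('o::{wellorder, order_bot} \<Rightarrow> nat \<Rightarrow> 'o) \<Rightarrow> 'o \<Rightarrow> problem" where
  "ACC ell \<alpha> = (\<lambda>p. if (\<alpha>, p) \<in> ACC_dom ell then Some {y. ACC_sol ell \<alpha> p y} else None)"

lemma dom_ACC: "dom (ACC ell \<alpha>) = {p. (\<alpha>, p) \<in> ACC_dom ell}"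
  by (auto simp: ACC_def dom_def)

lemma hashes_neq_conc: "hashes \<noteq> (replicate j hash @ [num n]) \<frown> w"
proof
  assume "hashes = (replicate j hash @ [num n]) \<frown> w"
  from fun_cong[OF this, of j] show False
    by (simp add: conc_def nth_append)
qed

lemma conc_inject:
  assumes eq: "(replicate j hash @ [num n]) \<frown> w = (replicate j' hash @ [num n']) \<frown> w'"
  shows "j = j' \<and> n = n' \<and> w = w'"
proof -
  have nth: "((replicate j hash @ [num n]) \<frown> w) i =
      (if i < j then 0 else if i = j then Suc n else w (i - Suc j))" for i j n w
    by (auto simp: conc_def nth_append)
  have le: "\<not> j < j'"
    if "(replicate j hash @ [num n]) \<frown> w = (replicate j' hash @ [num n']) \<frown> w'" for j n w j' n' w'
    using fun_cong[OF that, of j] by (auto simp: nth)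
  have j: "j = j'"
    using le[OF eq] le[OF eq[symmetric]] by simp
  moreover have "n = n'"
    using fun_cong[OF eq, of j] j by (simp add: nth)
  moreover have "w = w'"
  proof
    show "w i = w' i" for i
      using fun_cong[OF eq, of "Suc j + i"] j by (simp add: nth)
  qed
  ultimately show ?thesis
    by simp
qed

lemma ACC_bot: "ACC ell bot = [hashes \<mapsto> {}]"
proof -
  have "(bot, p) \<in> ACC_dom ell \<longleftrightarrow> p = hashes" for p
    by (auto elim: ACC_dom.cases intro: ACC_dom.hashes)
  moreover have "\<not> ACC_sol ell bot p y" for p y
    by (auto elim: ACC_sol.cases)
  ultimately show ?thesis
    by (auto simp: ACC_def fun_eq_iff)
qed

lemma dom_ACC_pos:
  assumes "bot < \<alpha>"
  shows "dom (ACC ell \<alpha>) = {hashes} \<union>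
    {(replicate j hash @ [num n]) \<frown> w | j n w. w \<in> dom (ACC ell (ell \<alpha> j))}"
proof -
  have "(\<alpha>, p) \<in> ACC_dom ell \<longleftrightarrow> p = hashes \<or>
      (\<exists>j n w. p = (replicate j hash @ [num n]) \<frown> w \<and> (ell \<alpha> j, w) \<in> ACC_dom ell)" for p
    using assms by (subst ACC_dom.simps) blast
  then show ?thesis
    unfolding dom_ACC by blast
qed

lemma ACC_pos_hashes:
  assumes "bot < \<alpha>"
  shows "ACC ell \<alpha> hashes = Some {[num m] \<frown> q | m q. True}"
proof -
  have "ACC_sol ell \<alpha> hashes y \<longleftrightarrow> (\<exists>m q. y = [num m] \<frown> q)" for y
    using assms hashes_neq_conc by (subst ACC_sol.simps) blast
  then have "{y. ACC_sol ell \<alpha> hashes y} = {[num m] \<frown> q | m q. True}"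
    by blast
  then show ?thesis
    by (simp only: ACC_def ACC_dom.hashes if_True)
qed

lemma ACC_pos_step:
  assumes "bot < \<alpha>" and "w \<in> dom (ACC ell (ell \<alpha> j))"
  shows "ACC ell \<alpha> ((replicate j hash @ [num n]) \<frown> w) = Some
    ({[num m] \<frown> q | m q. m \<noteq> n} \<union>
     {([num n] @ replicate k hash) \<frown> y | k y. y \<in> the (ACC ell (ell \<alpha> j) w)})"
proof -
  let ?p = "(replicate j hash @ [num n]) \<frown> w"
  have w: "(ell \<alpha> j, w) \<in> ACC_dom ell"
    using assms(2) by (simp add: dom_ACC)
  then have "(\<alpha>, ?p) \<in> ACC_dom ell"
    using assms(1) by (rule ACC_dom.step[rotated])
  moreover have "ACC_sol ell \<alpha> ?p y \<longleftrightarrow>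
      (\<exists>m q. y = [num m] \<frown> q \<and> m \<noteq> n) \<or>
      (\<exists>k z. y = ([num n] @ replicate k hash) \<frown> z \<and> ACC_sol ell (ell \<alpha> j) w z)"
    (is "?L \<longleftrightarrow> ?R") for y
  proof
    assume ?L
    then show ?R
    proof cases
      case hashes
      then show ?thesis
        using hashes_neq_conc by metis
    next
      case (avoid j' w' m n' q)
      then show ?thesis
        using conc_inject by blast
    next
      case (step j' w' z n' k)
      then show ?thesis
        using conc_inject by blast
    qed
  next
    assume ?R
    then show ?L
      using assms(1) w by (blast intro: ACC_sol.avoid ACC_sol.step)
  qed
  moreover have "the (ACC ell (ell \<alpha> j) w) = {y. ACC_sol ell (ell \<alpha> j) w y}"
    using w by (simp add: ACC_def)
  ultimately show ?thesis
    by (simp only: ACC_def if_True mem_Collect_eq option.inject) blast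
qed

end

theory Submission
  imports Defs
begin

text \<open>
  Both directions rest on the shape of an instance of \<open>ACC ell \<alpha>\<close>: the instance \<open>#\<^sup>\<omega>\<close> is a limit of
  instances \<open>#\<^sup>j n w\<close>, and a solver that answers \<open>m\<close> on \<open>#\<^sup>\<omega>\<close> still answers \<open>m\<close> on \<open>#\<^sup>j m w\<close> for all
  large \<open>j\<close>. There the answer \<open>m\<close> is the forbidden one, and the solver is left with the instance
  \<open>w\<close> of a problem of smaller rank. At rank zero there is no solution at all, so an adversary who
  plays the forbidden number on every level defeats each continuous solver.

  From a reduction to a discontinuous restriction. The adversary still wins if for
  each \<open>j\<close> a single number \<open>n\<close> may follow \<open>#\<^sup>j\<close>, as long as each number follows infinitely often.
  The resulting set \<open>core\<close> admits no realizer (\<open>core_no_realizer\<close>), but it is compact, and its derivative of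
  order \<open>\<alpha>\<close> contains at most the point \<open>#\<^sup>\<omega>\<close> (\<open>compact_core\<close>, \<open>cb_derivative_core\<close>). Continuous
  maps do not raise ranks on compact sets (\<open>cb_derivative_image_compact\<close>), so the image of the core
  under the forward function has ranks at most \<open>\<alpha>\<close>; a realizer of \<open>P\<close> on this image would yield
  one on the core.

  From a discontinuous restriction to a reduction. Let \<open>R\<close> be discontinuous with ranks at most \<open>\<beta>\<close>.
  Continuous realizers on cylinders can be glued, so some instance \<open>p\<close> has no neighbourhood on which
  \<open>R\<close> is continuous (\<open>discontinuous_at_point\<close>). For each solution \<open>q\<close> of \<open>p\<close> there is a prefix of \<open>q\<close>
  such that near \<open>p\<close>, with \<open>p\<close> itself removed, no continuous realizer has all its values extending
  this prefix: otherwise realizers for longer and longer prefixes could be glued to one that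
  converges to \<open>q\<close> at \<open>p\<close> (\<open>discontinuous_near_solution\<close>). This new discontinuity takes place at
  points of rank below \<open>\<beta>\<close> (\<open>discontinuous_at_smaller_rank\<close>). Enumerate countably many of these
  prefixes so that every solution of \<open>p\<close> extends one of them. The reduction maps \<open>#\<^sup>\<omega>\<close>
  to \<open>p\<close> and answers with the index of a prefix of the given solution; on \<open>#\<^sup>j n w\<close> it moves to
  instances near \<open>p\<close> at which the solutions that extend the prefix with index \<open>n\<close> are, by
  induction, hard enough to solve \<open>w\<close> (\<open>ACC_le_assemble\<close>, \<open>ACC_le_if_discontinuous\<close>). If \<open>p\<close> has no
  solution, the constant map to \<open>p\<close> is already a reduction.
\<close>

section \<open>Cylinders and continuity in Baire space\<close>

definition cyl :: "baire \<Rightarrow> nat \<Rightarrow> baire set" where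
  "cyl x k = {y. \<forall>i<k. y i = x i}"

lemma cyl_self [simp]: "x \<in> cyl x k"
  by (simp add: cyl_def)

lemma cyl_antimono: "k \<le> l \<Longrightarrow> cyl x l \<subseteq> cyl x k"
  by (auto simp: cyl_def)

lemma cyl_max: "cyl x (max k l) = cyl x k \<inter> cyl x l"
  by (auto simp: cyl_def less_max_iff_disj)

lemma cyl_eq: "y \<in> cyl x k \<Longrightarrow> cyl y k = cyl x k"
  by (auto simp: cyl_def)

lemma open_cyl: "open (cyl x k)"
proof -
  have "open {y :: baire. \<forall>i\<in>{..<k}. y i \<in> {x i}}"
    by (rule product_topology_basis') (auto simp: open_discrete)
  moreover have "cyl x k = {y. \<forall>i\<in>{..<k}. y i \<in> {x i}}"
    by (auto simp: cyl_def)
  ultimately show ?thesis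
    by simp
qed

text \<open>
  A basic open set of the product topology constrains finitely many coordinates, hence is
  determined by an initial segment.
\<close>

lemma open_contains_cyl:
  assumes "open U" and "x \<in> U"
  obtains k where "cyl x k \<subseteq> U"
proof -
  from assms(1) have "openin (product_topology (\<lambda>i. euclidean) UNIV) U"
    by (simp add: open_fun_def)
  from product_topology_open_contains_basis[OF this assms(2)]
  obtain X where X: "x \<in> (\<Pi>\<^sub>E i\<in>UNIV. X i)" "finite {i. X i \<noteq> UNIV}" "(\<Pi>\<^sub>E i\<in>UNIV. X i) \<subseteq> U"
    by auto
  obtain k where k: "{i. X i \<noteq> UNIV} \<subseteq> {..<k}"
    using finite_nat_iff_bounded[THEN iffD1, OF X(2)] by blast
  have "cyl x k \<subseteq> (\<Pi>\<^sub>E i\<in>UNIV. X i)"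
  proof
    fix y assume y: "y \<in> cyl x k"
    have "y i \<in> X i" for i
    proof (cases "i < k")
      case True
      then show ?thesis using y X(1) by (auto simp: cyl_def PiE_def)
    next
      case False
      then have "X i = UNIV" using k by blast
      then show ?thesis by simp
    qed
    then show "y \<in> (\<Pi>\<^sub>E i\<in>UNIV. X i)"
      by auto
  qed
  from this and X(3) have "cyl x k \<subseteq> U"
    by (rule subset_trans)
  then show thesis
    by (rule that)
qed

lemma islimpt_cyl: "x islimpt A \<longleftrightarrow> (\<forall>k. \<exists>y \<in> A \<inter> cyl x k. y \<noteq> x)"
proof
  assume L: "x islimpt A"
  show "\<forall>k. \<exists>y \<in> A \<inter> cyl x k. y \<noteq> x"
    using islimptE[OF L cyl_self open_cyl] by blast
next
  assume R: "\<forall>k. \<exists>y \<in> A \<inter> cyl x k. y \<noteq> x"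
  show "x islimpt A"
  proof (rule islimptI)
    fix U assume "x \<in> U" "open U"
    then obtain k where "cyl x k \<subseteq> U"
      using open_contains_cyl by metis
    then show "\<exists>y\<in>A. y \<in> U \<and> y \<noteq> x"
      using R by blast
  qed
qed

lemma continuous_on_cyl:
  fixes f :: "baire \<Rightarrow> baire"
  shows "continuous_on D f \<longleftrightarrow> (\<forall>x \<in> D. \<forall>k. \<exists>l. \<forall>y \<in> D \<inter> cyl x l. f y \<in> cyl (f x) k)"
proof
  assume f: "continuous_on D f"
  show "\<forall>x \<in> D. \<forall>k. \<exists>l. \<forall>y \<in> D \<inter> cyl x l. f y \<in> cyl (f x) k"
  proof (intro ballI allI)
    fix x k assume x: "x \<in> D"
    have "\<exists>A. open A \<and> x \<in> A \<and> (\<forall>y\<in>D. y \<in> A \<longrightarrow> f y \<in> B)"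
      if "open B" "f x \<in> B" for B
      using f x that unfolding continuous_on_topological by simp
    from this[OF open_cyl cyl_self, of k]
    obtain A where A: "open A" "x \<in> A" "\<forall>y\<in>D. y \<in> A \<longrightarrow> f y \<in> cyl (f x) k"
      by blast
    obtain l where "cyl x l \<subseteq> A"
      using open_contains_cyl[OF A(1,2)] .
    then show "\<exists>l. \<forall>y \<in> D \<inter> cyl x l. f y \<in> cyl (f x) k"
      using A(3) by blast
  qed
next
  assume R: "\<forall>x \<in> D. \<forall>k. \<exists>l. \<forall>y \<in> D \<inter> cyl x l. f y \<in> cyl (f x) k"
  show "continuous_on D f"
    unfolding continuous_on_topological
  proof (intro ballI allI impI)
    fix x B assume x: "x \<in> D" and B: "open B" "f x \<in> B"
    obtain k where k: "cyl (f x) k \<subseteq> B"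
      using open_contains_cyl[OF B] .
    obtain l where "\<forall>y \<in> D \<inter> cyl x l. f y \<in> cyl (f x) k"
      using R x by blast
    then show "\<exists>A. open A \<and> x \<in> A \<and> (\<forall>y\<in>D. y \<in> A \<longrightarrow> f y \<in> B)"
      using k by (intro exI[of _ "cyl x l"]) (auto simp: open_cyl)
  qed
qed

lemma continuous_on_pair_cyl:
  fixes f :: "baire \<times> baire \<Rightarrow> baire"
  shows "continuous_on E f \<longleftrightarrow>
    (\<forall>x q. (x, q) \<in> E \<longrightarrow> (\<forall>k. \<exists>l. \<forall>x' q'. (x', q') \<in> E \<and> x' \<in> cyl x l \<and> q' \<in> cyl q l
        \<longrightarrow> f (x', q') \<in> cyl (f (x, q)) k))" (is "_ \<longleftrightarrow> ?R")
proof
  assume f: "continuous_on E f"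
  show ?R
  proof (intro allI impI)
    fix x q k assume xq: "(x, q) \<in> E"
    have "\<exists>A. open A \<and> (x, q) \<in> A \<and> (\<forall>y\<in>E. y \<in> A \<longrightarrow> f y \<in> B)"
      if "open B" "f (x, q) \<in> B" for B
      using f xq that unfolding continuous_on_topological by simp
    from this[OF open_cyl cyl_self, of k]
    obtain A where A: "open A" "(x, q) \<in> A" "\<forall>y\<in>E. y \<in> A \<longrightarrow> f y \<in> cyl (f (x, q)) k"
      by blast
    obtain U V where UV: "open U" "open V" "(x, q) \<in> U \<times> V" "U \<times> V \<subseteq> A"
      using open_prod_elim[OF A(1,2)] .
    then have U: "open U" "x \<in> U" and V: "open V" "q \<in> V"
      by simp_all
    obtain l where l: "cyl x l \<subseteq> U"
      using open_contains_cyl[OF U] .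
    obtain m where m: "cyl q m \<subseteq> V"
      using open_contains_cyl[OF V] .
    have sub: "cyl x (max l m) \<subseteq> U" "cyl q (max l m) \<subseteq> V"
      using l m by (auto simp: cyl_max)
    show "\<exists>l. \<forall>x' q'. (x', q') \<in> E \<and> x' \<in> cyl x l \<and> q' \<in> cyl q l
        \<longrightarrow> f (x', q') \<in> cyl (f (x, q)) k"
    proof (intro exI allI impI)
      fix x' q' assume x': "(x', q') \<in> E \<and> x' \<in> cyl x (max l m) \<and> q' \<in> cyl q (max l m)"
      then have "(x', q') \<in> A"
        using sub UV(4) by (intro subsetD[OF UV(4)]) auto
      then show "f (x', q') \<in> cyl (f (x, q)) k"
        using A(3) x' by simp
    qed
  qed
next
  assume R: ?R
  show "continuous_on E f"
    unfolding continuous_on_topological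
  proof (intro ballI allI impI)
    fix z B assume z: "z \<in> E" and B: "open B" "f z \<in> B"
    obtain x q where xq: "z = (x, q)"
      by (cases z)
    obtain k where k: "cyl (f z) k \<subseteq> B"
      using open_contains_cyl[OF B] .
    obtain l where l: "\<forall>x' q'. (x', q') \<in> E \<and> x' \<in> cyl x l \<and> q' \<in> cyl q l
        \<longrightarrow> f (x', q') \<in> cyl (f z) k"
      using R z unfolding xq by blast
    have "open (cyl x l \<times> cyl q l)"
      by (intro open_Times open_cyl)
    then show "\<exists>A. open A \<and> z \<in> A \<and> (\<forall>y\<in>E. y \<in> A \<longrightarrow> f y \<in> B)"
      using l k xq by (intro exI[of _ "cyl x l \<times> cyl q l"]) auto
  qed
qed

lemma open_eval:
  fixes U :: "'b::topological_space set"
  assumes "open U"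
  shows "open {x :: 'a \<Rightarrow> 'b. x i \<in> U}"
  using product_topology_basis'[of "{i}" "\<lambda>_. U" "\<lambda>j. j"] assms by simp

text \<open>
  The separation classes are instantiated from the bottom up, since each instance has to be at
  least as general as the instances for the stronger classes. They are needed because in Baire
  space compact sets must be closed.
\<close>

instance "fun" :: (type, t0_space) t0_space
proof
  fix x y :: "'a \<Rightarrow> 'b"
  assume "x \<noteq> y"
  then obtain i where "x i \<noteq> y i"
    by auto
  then obtain U where "open U" "\<not> (x i \<in> U \<longleftrightarrow> y i \<in> U)"
    by (metis separation_t0)
  then show "\<exists>U. open U \<and> \<not> (x \<in> U \<longleftrightarrow> y \<in> U)"
    using open_eval[of U i] by (intro exI[of _ "{z. z i \<in> U}"]) simp
qed

instance "fun" :: (type, t1_space) t1_space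
proof
  fix x y :: "'a \<Rightarrow> 'b"
  assume "x \<noteq> y"
  then obtain i where "x i \<noteq> y i"
    by auto
  then obtain U where "open U" "x i \<in> U" "y i \<notin> U"
    using t1_space[of "x i" "y i"] by blast
  then show "\<exists>U. open U \<and> x \<in> U \<and> y \<notin> U"
    using open_eval[of U i] by (intro exI[of _ "{z. z i \<in> U}"]) simp
qed

instance "fun" :: (type, t2_space) t2_space
proof
  fix x y :: "'a \<Rightarrow> 'b"
  assume "x \<noteq> y"
  then obtain i where "x i \<noteq> y i"
    by auto
  then obtain U V where UV: "open U" "open V" "x i \<in> U" "y i \<in> V" "U \<inter> V = {}"
    using hausdorff[of "x i" "y i"] by metis
  then have "{z. z i \<in> U} \<inter> {z. z i \<in> V} = {}"
    by auto
  with UV show "\<exists>U V. open U \<and> open V \<and> x \<in> U \<and> y \<in> V \<and> U \<inter> V = {}"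
    using open_eval[of U i] open_eval[of V i]
    by (intro exI[of _ "{z. z i \<in> U}"] exI[of _ "{z. z i \<in> V}"]) simp
qed

section \<open>Cantor-Bendixson derivatives\<close>

lemma mem_cb_derivative:
  "p \<in> cb_derivative A \<alpha> \<longleftrightarrow> p \<in> A \<and> (\<forall>\<beta><\<alpha>. p \<in> derived (cb_derivative A \<beta>))"
  by (subst cb_derivative.simps) auto

lemma cb_derivative_subset: "cb_derivative A \<alpha> \<subseteq> A"
  using mem_cb_derivative[THEN iffD1] by (intro subsetI) fast

lemma cb_derivative_derived: "\<beta> < \<alpha> \<Longrightarrow> cb_derivative A \<alpha> \<subseteq> derived (cb_derivative A \<beta>)"
  using mem_cb_derivative[THEN iffD1] by (intro subsetI) fast

lemma cb_derivative_mono: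
  fixes \<alpha> :: "'o::wellorder"
  assumes "A \<subseteq> B"
  shows "cb_derivative A \<alpha> \<subseteq> cb_derivative B \<alpha>"
proof (induction \<alpha> rule: less_induct)
  case (less \<alpha>)
  have "derived (cb_derivative A \<beta>) \<subseteq> derived (cb_derivative B \<beta>)" if "\<beta> < \<alpha>" for \<beta>
    using less[OF that] by (rule derived_mono)
  with assms show ?case
    unfolding subset_iff mem_cb_derivative[of _ _ \<alpha>] by blast
qed

text \<open>
  The successor of \<open>\<alpha>\<close> need not be an element of the type of ordinals, so ranks at most \<open>\<alpha>\<close> are
  expressed by the emptiness of the derivative that follows the one of order \<open>\<alpha>\<close>. Unlike the
  pointwise formulation this is visibly monotone in the set and in \<open>\<alpha>\<close>.
\<close>

definition cb_rank_le :: "'a::topological_space set \<Rightarrow> 'o::wellorder \<Rightarrow> bool" where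
  "cb_rank_le A \<alpha> \<longleftrightarrow> derived (cb_derivative A \<alpha>) = {}"

lemma cb_rank_le_mono:
  assumes "cb_rank_le B \<beta>" and "A \<subseteq> B" and "\<beta> \<le> \<alpha>"
  shows "cb_rank_le A \<alpha>"
proof -
  have "cb_derivative A \<alpha> \<subseteq> cb_derivative B \<beta>"
    using cb_derivative_mono[OF assms(2)] cb_derivative_antimono[OF assms(3)] by blast
  then show ?thesis
    using derived_mono assms(1) unfolding cb_rank_le_def by blast
qed

text \<open>
  The rank of \<open>p\<close> is the least \<open>\<beta>\<close> for which \<open>p\<close> is missing from the derivative following the one of
  order \<open>\<beta>\<close>.
\<close>

lemma cb_rank_le_iff: "cb_rank_le A \<alpha> \<longleftrightarrow> (\<forall>p \<in> A. \<exists>\<beta> \<le> \<alpha>. has_cb_rank A p \<beta>)"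
proof
  assume L: "cb_rank_le A \<alpha>"
  show "\<forall>p \<in> A. \<exists>\<beta> \<le> \<alpha>. has_cb_rank A p \<beta>"
  proof
    fix p assume "p \<in> A"
    let ?Q = "\<lambda>\<beta>. p \<notin> derived (cb_derivative A \<beta>)"
    have \<alpha>: "?Q \<alpha>"
      using L by (simp add: cb_rank_le_def)
    have "p \<in> cb_derivative A (Least ?Q)"
      using \<open>p \<in> A\<close> not_less_Least[of _ ?Q] unfolding mem_cb_derivative[of p A "Least ?Q"] by blast
    then show "\<exists>\<beta> \<le> \<alpha>. has_cb_rank A p \<beta>"
      using LeastI[of ?Q, OF \<alpha>] Least_le[of ?Q, OF \<alpha>] by (auto simp: has_cb_rank_def)
  qed
next
  assume R: "\<forall>p \<in> A. \<exists>\<beta> \<le> \<alpha>. has_cb_rank A p \<beta>"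
  have "p \<notin> derived (cb_derivative A \<alpha>)" for p
  proof
    assume p: "p \<in> derived (cb_derivative A \<alpha>)"
    then have "p \<in> A"
      using cb_derivative_subset by (auto simp: derived_def)
    then obtain \<beta> where "\<beta> \<le> \<alpha>" "has_cb_rank A p \<beta>"
      using R by blast
    then show False
      using p derived_mono[OF cb_derivative_antimono[of \<beta> \<alpha> A]] by (auto simp: has_cb_rank_def)
  qed
  then show "cb_rank_le A \<alpha>"
    by (auto simp: cb_rank_le_def)
qed

lemma derived_subsingleton:
  fixes p :: "'a::t1_space"
  shows "A \<subseteq> {p} \<Longrightarrow> derived A = {}"
  unfolding derived_def using islimpt_finite[of A] finite_subset[of A "{p}"] by blast

lemma closed_derived:
  fixes A :: "'a::t1_space set"
  assumes "closed A"
  shows "closed (derived A)"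
  unfolding closed_limpt
proof (intro allI impI)
  fix x assume x: "x islimpt derived A"
  then have "x islimpt A"
    by (rule islimpt_subset) (auto simp: derived_def)
  then show "x \<in> derived A"
    using assms by (auto simp: derived_def closed_limpt)
qed

lemma closed_cb_derivative:
  fixes A :: "'a::t1_space set" and \<alpha> :: "'o::wellorder"
  assumes "closed A"
  shows "closed (cb_derivative A \<alpha>)"
proof (induction \<alpha> rule: less_induct)
  case (less \<alpha>)
  then show ?case
    using assms by (subst cb_derivative.simps) (intro closed_Int closed_INT ballI closed_derived; simp)
qed

text \<open>
  If all preimages of \<open>y\<close> were isolated in \<open>C\<close>, removing them would leave a compact set. Its image
  is closed, so \<open>y\<close> could not be approximated by other points of the image.
\<close>

lemma derived_image_compact:
  fixes f :: "'a::t2_space \<Rightarrow> 'b::t2_space"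
  assumes C: "compact C" and f: "continuous_on C f" and y: "y \<in> derived (f ` C)"
  shows "\<exists>b \<in> derived C. f b = y"
proof (rule ccontr)
  assume no: "\<not> ?thesis"
  let ?D = "C - f -` {y}"
  have "closed ?D"
    unfolding closed_limpt
  proof (intro allI impI)
    fix b assume "b islimpt ?D"
    then have "b islimpt C"
      by (rule islimpt_subset) blast
    moreover from this have "b \<in> C"
      using compact_imp_closed[OF C] by (simp add: closed_limpt)
    ultimately show "b \<in> ?D"
      using no by (auto simp: derived_def)
  qed
  then have "compact ?D"
    using C compact_Int_closed[of C ?D] by (simp add: Int_absorb1 Diff_subset)
  then have "compact (f ` ?D)"
    using f by (intro compact_continuous_image) (auto intro: continuous_on_subset)
  then have cl: "closed (f ` ?D)"
    by (rule compact_imp_closed)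
  have "f ` ?D = f ` C - {y}"
    by auto
  moreover have "y islimpt f ` C - {y}"
    using y islimpt_punctured[of y "f ` C"] by (simp add: derived_def)
  ultimately show False
    using cl unfolding closed_limpt by auto
qed

text \<open>
  Each earlier derivative contains a non-isolated preimage of \<open>y\<close>. The sets of these preimages are
  compact and decrease, so some preimage serves all orders below \<open>\<alpha>\<close> at once. Compactness is
  essential: a discrete set can be mapped onto the rationals.
\<close>

lemma cb_derivative_image_compact:
  fixes f :: "'a::t2_space \<Rightarrow> 'b::t2_space" and \<alpha> :: "'o::wellorder"
  assumes C: "compact C" and f: "continuous_on C f"
  shows "cb_derivative (f ` C) \<alpha> \<subseteq> f ` cb_derivative C \<alpha>"
proof (induction \<alpha> rule: less_induct)
  case (less \<alpha>)
  show ?case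
  proof
    fix y assume y: "y \<in> cb_derivative (f ` C) \<alpha>"
    let ?K = "\<lambda>\<beta>. derived (cb_derivative C \<beta>)"
    let ?F = "C \<inter> f -` {y}"
    have "closed ?F"
      using continuous_closed_preimage[OF f compact_imp_closed[OF C]] by simp
    then have F: "compact ?F"
      using compact_Int_closed[OF C, of ?F] by simp
    have cpt: "compact (cb_derivative C \<beta>)" for \<beta> :: 'o
      using compact_Int_closed[OF C closed_cb_derivative[OF compact_imp_closed[OF C], of \<beta>]]
      by (simp add: Int_absorb1 cb_derivative_subset)
    have clK: "closed (?K \<beta>)" for \<beta> :: 'o
      by (intro closed_derived closed_cb_derivative compact_imp_closed C)
    have ne: "?F \<inter> ?K \<beta> \<noteq> {}" if \<beta>: "\<beta> < \<alpha>" for \<beta> :: 'o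
    proof -
      have "y \<in> derived (cb_derivative (f ` C) \<beta>)"
        using y cb_derivative_derived[OF \<beta>] by blast
      then have "y \<in> derived (f ` cb_derivative C \<beta>)"
        using derived_mono[OF less[OF \<beta>]] by blast
      then obtain b where b: "b \<in> ?K \<beta>" "f b = y"
        using derived_image_compact[OF cpt continuous_on_subset[OF f cb_derivative_subset]] by blast
      then have "b \<in> C"
        using cb_derivative_subset[of C \<beta>] by (auto simp: derived_def)
      with b show ?thesis
        by blast
    qed
    have "?F \<inter> (\<Inter>\<beta>\<in>{..<\<alpha>}. ?K \<beta>) \<noteq> {}"
    proof (rule compact_imp_fip_image[OF F])
      fix I :: "'o set" assume I: "finite I" "I \<subseteq> {..<\<alpha>}"
      show "?F \<inter> (\<Inter>\<beta>\<in>I. ?K \<beta>) \<noteq> {}"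
      proof (cases "I = {}")
        case True
        then show ?thesis
          using y cb_derivative_subset[of "f ` C" \<alpha>] by auto
      next
        case False
        then have M: "Max I \<in> I" "\<And>\<beta>. \<beta> \<in> I \<Longrightarrow> \<beta> \<le> Max I"
          using I by simp_all
        \<comment> \<open>The derivatives decrease, so a finite intersection is its last member.\<close>
        have "?K (Max I) \<subseteq> ?K \<beta>" if "\<beta> \<in> I" for \<beta>
          using derived_mono[OF cb_derivative_antimono[OF M(2)[OF that]]] by blast
        then show ?thesis
          using ne[of "Max I"] M(1) I(2) by blast
      qed
    qed (use clK in auto)
    then obtain b where "b \<in> C" "f b = y" "\<And>\<beta>. \<beta> < \<alpha> \<Longrightarrow> b \<in> ?K \<beta>"
      by auto
    then have "b \<in> cb_derivative C \<alpha>"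
      unfolding mem_cb_derivative[of b C \<alpha>] by blast
    then show "y \<in> f ` cb_derivative C \<alpha>"
      using \<open>f b = y\<close> by blast
  qed
qed

lemma cb_derivative_Int_open:
  fixes \<alpha> :: "'o::wellorder"
  assumes "open U"
  shows "cb_derivative A \<alpha> \<inter> U \<subseteq> cb_derivative (A \<inter> U) \<alpha>"
proof (induction \<alpha> rule: less_induct)
  case (less \<alpha>)
  show ?case
  proof
    fix x assume x: "x \<in> cb_derivative A \<alpha> \<inter> U"
    have "x \<in> derived (cb_derivative (A \<inter> U) \<beta>)" if \<beta>: "\<beta> < \<alpha>" for \<beta>
    proof -
      have "x \<in> derived (cb_derivative A \<beta>)"
        using x cb_derivative_derived[OF \<beta>] by blast
      then have "x \<in> derived (cb_derivative A \<beta> \<inter> U)"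
        using x assms by (auto simp: derived_def islimpt_Int_eventually eventually_at_in_open')
      then show ?thesis
        using derived_mono[OF less[OF \<beta>]] by blast
    qed
    then show "x \<in> cb_derivative (A \<inter> U) \<alpha>"
      using x cb_derivative_subset[of A \<alpha>] unfolding mem_cb_derivative[of x "A \<inter> U" \<alpha>] by blast
  qed
qed

section \<open>Realizers and reductions\<close>

text \<open>
  For realizers and reductions, continuity is required exactly on the set where it matters. This
  is equivalent to the existence of some larger domain of continuity, and it makes continuity on
  subsets and of compositions immediate.
\<close>

definition realizes :: "(baire \<Rightarrow> baire) \<Rightarrow> problem \<Rightarrow> bool" where
  "realizes f R \<longleftrightarrow> continuous_on (dom R) f \<and> (\<forall>p \<in> dom R. f p \<in> the (R p))"

lemma continuous_problem_iff: "continuous_problem R \<longleftrightarrow> (\<exists>f. realizes f R)"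
proof
  assume "continuous_problem R"
  then obtain D f where f: "continuous_on D f" "\<forall>p \<in> dom R. p \<in> D \<and> f p \<in> the (R p)"
    unfolding continuous_problem_def by (elim exE conjE)
  then have "continuous_on (dom R) f"
    by (intro continuous_on_subset[OF f(1)]) auto
  with f show "\<exists>f. realizes f R"
    unfolding realizes_def by auto
next
  assume "\<exists>f. realizes f R"
  then show "continuous_problem R"
    unfolding continuous_problem_def realizes_def by metis
qed

definition reduction :: "(baire \<Rightarrow> baire) \<Rightarrow> (baire \<times> baire \<Rightarrow> baire) \<Rightarrow> problem \<Rightarrow> problem \<Rightarrow> bool" where
  "reduction \<Phi> \<Psi> P Q \<longleftrightarrow>
     continuous_on (dom P) \<Phi> \<and> (\<forall>p \<in> dom P. \<Phi> p \<in> dom Q) \<and>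
     continuous_on {(p, q). p \<in> dom P \<and> q \<in> the (Q (\<Phi> p))} \<Psi> \<and>
     (\<forall>p \<in> dom P. \<forall>q \<in> the (Q (\<Phi> p)). \<Psi> (p, q) \<in> the (P p))"

lemma cont_weihrauch_le_iff: "P \<le>\<^sub>W Q \<longleftrightarrow> (\<exists>\<Phi> \<Psi>. reduction \<Phi> \<Psi> P Q)"
proof
  assume "P \<le>\<^sub>W Q"
  then obtain D \<Phi> E \<Psi> where *: "continuous_on D \<Phi>" "continuous_on E \<Psi>"
    "\<forall>p \<in> dom P. p \<in> D \<and> \<Phi> p \<in> dom Q \<and> (\<forall>q \<in> the (Q (\<Phi> p)). (p, q) \<in> E \<and> \<Psi> (p, q) \<in> the (P p))"
    unfolding cont_weihrauch_le_def by (elim exE conjE)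
  have "continuous_on (dom P) \<Phi>"
    using * by (intro continuous_on_subset[OF *(1)]) auto
  moreover have "continuous_on {(p, q). p \<in> dom P \<and> q \<in> the (Q (\<Phi> p))} \<Psi>"
    using * by (intro continuous_on_subset[OF *(2)]) auto
  ultimately show "\<exists>\<Phi> \<Psi>. reduction \<Phi> \<Psi> P Q"
    unfolding reduction_def using *(3) by (intro exI[of _ \<Phi>] exI[of _ \<Psi>]) simp
next
  assume "\<exists>\<Phi> \<Psi>. reduction \<Phi> \<Psi> P Q"
  then obtain \<Phi> \<Psi> where "reduction \<Phi> \<Psi> P Q"
    by blast
  then show "P \<le>\<^sub>W Q"
    unfolding cont_weihrauch_le_def reduction_def
    by (intro exI[of _ "dom P"] exI[of _ \<Phi>] exI[of _ \<Psi>]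
        exI[of _ "{(p, q). p \<in> dom P \<and> q \<in> the (Q (\<Phi> p))}"]) simp
qed

section \<open>Words with one marked position\<close>

text \<open>
  An instance of \<open>ACC ell \<alpha>\<close> other than \<open>#\<^sup>\<omega>\<close> is a block \<open>#\<^sup>j n w\<close>. As a constant, unlike the word it
  stands for, it is not taken apart by the rewrite rules for concatenation.
\<close>

definition block :: "nat \<Rightarrow> nat \<Rightarrow> baire \<Rightarrow> baire" where
  "block j n w = (replicate j hash @ [num n]) \<frown> w"

lemma block_nth: "block j n w i = (if i < j then 0 else if i = j then Suc n else w (i - Suc j))"
  by (auto simp: block_def conc_def nth_append)

lemma hashes_neq_block: "hashes \<noteq> block j n w"
  using hashes_neq_conc by (simp only: block_def not_False_eq_True)

lemma block_inject: "block j n w = block j' n' w' \<longleftrightarrow> j = j' \<and> n = n' \<and> w = w'"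
  using conc_inject unfolding block_def by blast

lemma block_mem_cyl_hashes: "block j n w \<in> cyl hashes k \<longleftrightarrow> k \<le> j"
proof
  assume "block j n w \<in> cyl hashes k"
  then have "j < k \<longrightarrow> block j n w j = 0"
    by (simp add: cyl_def)
  then show "k \<le> j"
    by (simp add: block_nth)
qed (simp add: cyl_def block_nth)

text \<open>
  Blocks with fixed \<open>j\<close> and \<open>n\<close> form a clopen copy of Baire space.
\<close>

lemma cyl_block: "cyl (block j n w) (Suc j + l) = block j n ` cyl w l"
proof (intro equalityI subsetI)
  fix y assume y: "y \<in> cyl (block j n w) (Suc j + l)"
  have "y i = block j n (suffix (Suc j) y) i" for i
    using y by (auto simp: cyl_def block_nth)
  moreover have "suffix (Suc j) y \<in> cyl w l"
    using y by (auto simp: cyl_def block_nth)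
  ultimately show "y \<in> block j n ` cyl w l"
    by blast
next
  fix y assume "y \<in> block j n ` cyl w l"
  then show "y \<in> cyl (block j n w) (Suc j + l)"
    by (auto simp: cyl_def block_nth)
qed

lemma continuous_on_block: "continuous_on D (block j n)"
  unfolding continuous_on_cyl
proof (intro ballI allI)
  fix x k assume "x \<in> D"
  have "block j n y \<in> cyl (block j n x) k" if "y \<in> cyl x k" for y
    using that by (auto simp: cyl_def block_nth)
  then show "\<exists>l. \<forall>y \<in> D \<inter> cyl x l. block j n y \<in> cyl (block j n x) k"
    by auto
qed

section \<open>A compact core of the domain\<close>

text \<open>
  After \<open>#\<^sup>j\<close> the core allows only one number, the first component of the pair coded by \<open>j\<close>. Allowing
  finitely many numbers makes the core compact, and each number still occurs for arbitrarily
  large \<open>j\<close>, as an adversary of a continuous realizer requires.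
\<close>

inductive_set core :: "('o::{wellorder, order_bot} \<Rightarrow> nat \<Rightarrow> 'o) \<Rightarrow> ('o \<times> baire) set"
  for ell where
  hashes: "(\<alpha>, hashes) \<in> core ell"
| step: "\<lbrakk>bot < \<alpha>; (ell \<alpha> j, w) \<in> core ell\<rbrakk> \<Longrightarrow>
    (\<alpha>, block j (fst (prod_decode j)) w) \<in> core ell"

lemma core_subset_ACC_dom: "core ell \<subseteq> ACC_dom ell"
proof (intro subrelI)
  show "(\<alpha>, p) \<in> ACC_dom ell" if "(\<alpha>, p) \<in> core ell" for \<alpha> p
    using that by induction (simp_all only: block_def ACC_dom.intros)
qed

lemma core_bot: "core ell `` {bot} = {hashes}"
  by (auto elim: core.cases intro: core.hashes)

lemma core_pos:
  assumes "bot < \<alpha>"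
  shows "core ell `` {\<alpha>} =
    insert hashes (\<Union>j. block j (fst (prod_decode j)) ` (core ell `` {ell \<alpha> j}))"
proof -
  have "(\<alpha>, p) \<in> core ell \<longleftrightarrow> p = hashes \<or>
      (\<exists>j w. p = block j (fst (prod_decode j)) w \<and> (ell \<alpha> j, w) \<in> core ell)" for p
    using assms by (subst core.simps) blast
  then show ?thesis
    by blast
qed

lemma rank_witnessing_representation_le:
  "rank_witnessing_representation \<alpha> ell \<Longrightarrow> \<beta> \<le> \<alpha> \<Longrightarrow> rank_witnessing_representation \<beta> ell"
  unfolding rank_witnessing_representation_def by (meson order_trans)

lemma rank_witnessing_representation_less:
  "rank_witnessing_representation \<alpha> ell \<Longrightarrow> bot < \<alpha> \<Longrightarrow> ell \<alpha> j < \<alpha>"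
  unfolding rank_witnessing_representation_def rank_witnessing_def by auto

lemma rank_witnessing_representation_ell:
  assumes "rank_witnessing_representation \<alpha> ell" and "bot < \<alpha>"
  shows "rank_witnessing_representation (ell \<alpha> j) ell"
  using rank_witnessing_representation_le[OF assms(1)]
    rank_witnessing_representation_less[OF assms] by (simp add: order_less_imp_le)

text \<open>
  An open set around \<open>z\<close> contains all but finitely many of the sets \<open>S j\<close>.
\<close>

lemma compact_insert_UN_cyl:
  assumes S: "\<And>j. compact (S j)" and sub: "\<And>j. S j \<subseteq> cyl z j"
  shows "compact (insert z (\<Union>j. S j))"
proof (rule compactI)
  fix \<C> assume op: "\<forall>U\<in>\<C>. open U" and cov: "insert z (\<Union>j. S j) \<subseteq> \<Union>\<C>"
  then obtain U where U: "U \<in> \<C>" "z \<in> U"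
    by auto
  then obtain k where k: "cyl z k \<subseteq> U"
    using open_contains_cyl op by metis
  have "compact (\<Union>j<k. S j)"
    using S by (intro compact_UN) auto
  moreover have "(\<Union>j<k. S j) \<subseteq> \<Union>\<C>"
    using cov by auto
  ultimately obtain \<D> where \<D>: "\<D> \<subseteq> \<C>" "finite \<D>" "(\<Union>j<k. S j) \<subseteq> \<Union>\<D>"
    using op by (elim compactE) auto
  have "S j \<subseteq> U \<union> \<Union>\<D>" for j
  proof (cases "j < k")
    case True
    then have "S j \<subseteq> \<Union>\<D>"
      using \<D>(3) by auto
    then show ?thesis
      by auto
  next
    case False
    then have "S j \<subseteq> U"
      using sub[of j] cyl_antimono[of k j z] k by auto
    then show ?thesis
      by auto
  qed
  then have "insert z (\<Union>j. S j) \<subseteq> \<Union>(insert U \<D>)"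
    using U(2) by auto
  then show "\<exists>\<D>\<subseteq>\<C>. finite \<D> \<and> insert z (\<Union>j. S j) \<subseteq> \<Union>\<D>"
    using U(1) \<D>(1,2) by (intro exI[of _ "insert U \<D>"]) auto
qed

lemma compact_core:
  fixes \<alpha> :: "'o::{wellorder, order_bot}"
  assumes "rank_witnessing_representation \<alpha> ell"
  shows "compact (core ell `` {\<alpha>})"
  using assms
proof (induction \<alpha> rule: less_induct)
  case (less \<alpha>)
  show ?case
  proof (cases "\<alpha> = bot")
    case True
    then show ?thesis
      by (simp add: core_bot)
  next
    case False
    then have \<alpha>: "bot < \<alpha>"
      by (simp add: bot.not_eq_extremum)
    have "compact (core ell `` {ell \<alpha> j})" for j
      using less.IH rank_witnessing_representation_less[OF less.prems \<alpha>]
        rank_witnessing_representation_ell[OF less.prems \<alpha>] .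
    then show ?thesis
      unfolding core_pos[OF \<alpha>]
      by (intro compact_insert_UN_cyl compact_continuous_image continuous_on_block)
        (auto simp: block_mem_cyl_hashes)
  qed
qed

text \<open>
  A point other than \<open>#\<^sup>\<omega>\<close> has a neighbourhood in which the core is a copy of the core for
  \<open>ell \<alpha> j\<close>, whose derivatives vanish after the order \<open>ell \<alpha> j < \<alpha>\<close>.
\<close>

lemma cb_derivative_core:
  fixes \<alpha> :: "'o::{wellorder, order_bot}"
  assumes "rank_witnessing_representation \<alpha> ell"
  shows "cb_derivative (core ell `` {\<alpha>}) \<alpha> \<subseteq> {hashes}"
  using assms
proof (induction \<alpha> rule: less_induct)
  case (less \<alpha>)
  show ?case
  proof (cases "\<alpha> = bot")
    case True
    then show ?thesis
      by (simp add: core_bot cb_derivative_bot)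
  next
    case False
    then have \<alpha>: "bot < \<alpha>"
      by (simp add: bot.not_eq_extremum)
    have "x = hashes" if x: "x \<in> cb_derivative (core ell `` {\<alpha>}) \<alpha>" for x
    proof (rule ccontr)
      assume "x \<noteq> hashes"
      moreover have "x \<in> core ell `` {\<alpha>}"
        using x cb_derivative_subset by auto
      ultimately obtain j w where xw: "x = block j (fst (prod_decode j)) w"
        unfolding core_pos[OF \<alpha>] by auto
      let ?B = "block j (fst (prod_decode j))" and ?K = "core ell `` {ell \<alpha> j}"
      have lt: "ell \<alpha> j < \<alpha>"
        using rank_witnessing_representation_less[OF less.prems \<alpha>] .
      have rw: "rank_witnessing_representation (ell \<alpha> j) ell"
        using rank_witnessing_representation_ell[OF less.prems \<alpha>] .
      have "core ell `` {\<alpha>} \<inter> cyl x (Suc j) \<subseteq> ?B ` ?K"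
      proof
        fix y assume y: "y \<in> core ell `` {\<alpha>} \<inter> cyl x (Suc j)"
        then have "y j = Suc (fst (prod_decode j))"
          by (simp add: xw cyl_def block_nth)
        then have "y \<noteq> hashes"
          by auto
        then obtain i v where i: "y = block i (fst (prod_decode i)) v" "v \<in> core ell `` {ell \<alpha> i}"
          using y unfolding core_pos[OF \<alpha>] by auto
        obtain v' where "y = ?B v'"
          using y cyl_block[of j "fst (prod_decode j)" w 0] unfolding xw by auto
        then have "i = j"
          using i(1) block_inject by simp
        then show "y \<in> ?B ` ?K"
          using i by auto
      qed
      then have "x \<in> cb_derivative (?B ` ?K) \<alpha>"
        using x cb_derivative_Int_open[OF open_cyl[of x "Suc j"], of "core ell `` {\<alpha>}" \<alpha>]
          cb_derivative_mono[of _ "?B ` ?K" \<alpha>] cyl_self[of x "Suc j"] by blast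
      then have "x \<in> ?B ` cb_derivative ?K \<alpha>"
        using cb_derivative_image_compact[OF compact_core[OF rw] continuous_on_block] by blast
      moreover have "cb_derivative ?K \<alpha> \<subseteq> derived (cb_derivative ?K (ell \<alpha> j))"
        using cb_derivative_derived[OF lt] .
      moreover have "derived (cb_derivative ?K (ell \<alpha> j)) = {}"
        using derived_subsingleton[OF less.IH[OF lt rw]] .
      ultimately show False
        by simp
    qed
    then show ?thesis
      by auto
  qed
qed

section \<open>The core admits no realizer\<close>

lemma ACC_sol_first: "ACC_sol ell \<alpha> p y \<Longrightarrow> y 0 \<noteq> 0"
  by (cases rule: ACC_sol.cases) auto

text \<open>
  Recovers \<open>y\<close> from \<open>n #\<^sup>k y\<close> without knowledge of \<open>k\<close>. This works because a solution always starts
  with a number, and it is continuous because the end of the run of hashes is eventually seen.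
\<close>

definition strip :: "baire \<Rightarrow> baire" where
  "strip x = suffix (LEAST i. 0 < i \<and> x i \<noteq> 0) x"

lemma strip_conc:
  assumes "y 0 \<noteq> 0"
  shows "strip (([num m] @ replicate k hash) \<frown> y) = y"
proof -
  define x where "x = ([num m] @ replicate k hash) \<frown> y"
  have nth: "x i = (if i = 0 then Suc m else if i \<le> k then 0 else y (i - Suc k))" for i
    by (cases i) (auto simp: x_def conc_def nth_append)
  have "(LEAST i. 0 < i \<and> x i \<noteq> 0) = Suc k"
    by (rule Least_equality) (use assms in \<open>auto simp: nth not_less_eq_eq split: if_splits\<close>)
  then have "strip x = y"
    unfolding strip_def by (simp add: fun_eq_iff nth)
  then show ?thesis
    by (simp only: x_def)
qed

lemma ACC_sol_block:
  assumes "ACC_sol ell \<alpha> (block j n w) y" and "y 0 = Suc n"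
  obtains k z where "y = ([num n] @ replicate k hash) \<frown> z" "ACC_sol ell (ell \<alpha> j) w z"
  using assms(1)
proof cases
  case (hashes m q)
  then show ?thesis
    using hashes_neq_block by metis
next
  case (avoid j' w' m n' q)
  then have "y 0 = Suc m" "n' = n"
    by (simp, simp only: block_def[symmetric] block_inject)
  then show ?thesis
    using assms(2) avoid(5) by simp
next
  case (step j' w' z n' k)
  then have "j' = j \<and> n' = n \<and> w' = w"
    by (simp only: block_def[symmetric] block_inject)
  then show ?thesis
    using that step by blast
qed

lemma continuous_on_strip: "continuous_on {x. \<exists>i>0. x i \<noteq> 0} strip"
  unfolding continuous_on_cyl
proof (intro ballI allI)
  fix x :: baire and k assume "x \<in> {x. \<exists>i>0. x i \<noteq> 0}"
  then obtain i where i: "0 < i \<and> x i \<noteq> 0"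
    by auto
  define l where "l = (LEAST i. 0 < i \<and> x i \<noteq> 0)"
  have l: "0 < l \<and> x l \<noteq> 0"
    unfolding l_def by (rule LeastI[of _ i]) (rule i)
  have "strip y \<in> cyl (strip x) k" if y: "y \<in> cyl x (Suc l + k)" for y
  proof -
    have "(LEAST i. 0 < i \<and> y i \<noteq> 0) = l"
    proof (rule Least_equality)
      show "0 < l \<and> y l \<noteq> 0"
        using l y by (simp add: cyl_def)
      show "l \<le> i" if "0 < i \<and> y i \<noteq> 0" for i
      proof (rule ccontr)
        assume "\<not> l \<le> i"
        then have "0 < i \<and> x i \<noteq> 0"
          using that y by (auto simp: cyl_def)
        then show False
          using \<open>\<not> l \<le> i\<close> Least_le[of "\<lambda>i. 0 < i \<and> x i \<noteq> 0" i] by (simp add: l_def)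
      qed
    qed
    then show ?thesis
      using y unfolding strip_def l_def[symmetric] by (auto simp: cyl_def)
  qed
  then show "\<exists>l. \<forall>y\<in>{x. \<exists>i>0. x i \<noteq> 0} \<inter> cyl x l. strip y \<in> cyl (strip x) k"
    by auto
qed

text \<open>
  A continuous \<open>f\<close> decides its first number \<open>m\<close> on \<open>#\<^sup>\<omega>\<close> after reading finitely many hashes. Playing
  \<open>m\<close> after a sufficiently long run of hashes forces \<open>f\<close> to solve the rest of the instance, and
  stripping \<open>m #\<^sup>k\<close> from its values gives a realizer at the smaller ordinal \<open>ell \<alpha> j\<close>.
\<close>

lemma core_no_realizer:
  fixes \<alpha> :: "'o::{wellorder, order_bot}"
  assumes "rank_witnessing_representation \<alpha> ell"
    and "continuous_on (core ell `` {\<alpha>}) f"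
    and "\<And>p. p \<in> core ell `` {\<alpha>} \<Longrightarrow> ACC_sol ell \<alpha> p (f p)"
  shows False
  using assms
proof (induction \<alpha> arbitrary: f rule: less_induct)
  case (less \<alpha>)
  have h: "hashes \<in> core ell `` {\<alpha>}"
    by (simp add: core.hashes)
  have sol: "ACC_sol ell \<alpha> hashes (f hashes)"
    using less.prems(3)[OF h] .
  then have \<alpha>: "bot < \<alpha>"
    by cases auto
  obtain m where m: "f hashes 0 = Suc m"
    using ACC_sol_first[OF sol] not0_implies_Suc by blast
  obtain N where N: "\<forall>y \<in> core ell `` {\<alpha>} \<inter> cyl hashes N. f y \<in> cyl (f hashes) 1"
    using less.prems(2) h unfolding continuous_on_cyl by blast
  \<comment> \<open>This position allows the number \<open>m\<close> in the core, and it lies beyond the prefix read by \<open>f\<close>.\<close>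
  define j where "j = prod_encode (m, N)"
  have j: "N \<le> j" "fst (prod_decode j) = m"
    by (simp_all add: j_def le_prod_encode_2)
  let ?K = "core ell `` {ell \<alpha> j}"
  have dom: "block j m w \<in> core ell `` {\<alpha>}" if "w \<in> ?K" for w
    using core.step[OF \<alpha>, of ell j w] that by (simp add: j(2))
  have sol: "ACC_sol ell (ell \<alpha> j) w (strip (f (block j m w))) \<and> (\<exists>i>0. f (block j m w) i \<noteq> 0)"
    if w: "w \<in> ?K" for w
  proof -
    have fst: "f (block j m w) 0 = Suc m"
    proof -
      have "block j m w \<in> core ell `` {\<alpha>} \<inter> cyl hashes N"
        using dom[OF w] j(1) by (simp add: block_mem_cyl_hashes)
      then have "f (block j m w) \<in> cyl (f hashes) 1"
        using N by blast
      then show ?thesis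
        using m by (simp add: cyl_def)
    qed
    obtain k z where z: "f (block j m w) = ([num m] @ replicate k hash) \<frown> z"
        "ACC_sol ell (ell \<alpha> j) w z"
      using ACC_sol_block[OF less.prems(3)[OF dom[OF w]] fst] .
    have "z 0 \<noteq> 0"
      using ACC_sol_first[OF z(2)] .
    moreover have "f (block j m w) (Suc k) = z 0"
      unfolding z(1) by (simp add: conc_def)
    ultimately have "\<exists>i>0. f (block j m w) i \<noteq> 0"
      by (intro exI[of _ "Suc k"]) simp
    then show ?thesis
      using z(2) strip_conc[of z m k, OF \<open>z 0 \<noteq> 0\<close>] unfolding z(1) by simp
  qed
  show False
  proof (rule less.IH)
    show "ell \<alpha> j < \<alpha>"
      using rank_witnessing_representation_less[OF less.prems(1) \<alpha>] .
    show "rank_witnessing_representation (ell \<alpha> j) ell"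
      using rank_witnessing_representation_ell[OF less.prems(1) \<alpha>] .
    have "continuous_on ?K (\<lambda>w. f (block j m w))"
      by (rule continuous_on_compose2[OF less.prems(2) continuous_on_block]) (use dom in auto)
    then show "continuous_on ?K (\<lambda>w. strip (f (block j m w)))"
      by (rule continuous_on_compose2[OF continuous_on_strip]) (use sol in auto)
    show "ACC_sol ell (ell \<alpha> j) w (strip (f (block j m w)))" if "w \<in> ?K" for w
      using sol[OF that] by blast
  qed
qed

lemma the_ACC: "p \<in> dom (ACC ell \<alpha>) \<Longrightarrow> the (ACC ell \<alpha> p) = {y. ACC_sol ell \<alpha> p y}"
  by (auto simp: ACC_def split: if_splits)

theorem discontinuous_restriction_if_ACC_le:
  fixes \<alpha> :: "'o::{wellorder, order_bot}"
  assumes rw: "rank_witnessing_representation \<alpha> ell" and le: "ACC ell \<alpha> \<le>\<^sub>W P"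
  shows "\<exists>A. \<not> continuous_problem (P |` A) \<and> cb_rank_le A \<alpha>"
proof -
  obtain \<Phi> \<Psi> where red: "reduction \<Phi> \<Psi> (ACC ell \<alpha>) P"
    using le unfolding cont_weihrauch_le_iff by blast
  then have \<Phi>: "continuous_on (dom (ACC ell \<alpha>)) \<Phi>"
      "\<And>p. p \<in> dom (ACC ell \<alpha>) \<Longrightarrow> \<Phi> p \<in> dom P"
    and \<Psi>: "continuous_on {(p, q). p \<in> dom (ACC ell \<alpha>) \<and> q \<in> the (P (\<Phi> p))} \<Psi>"
      "\<And>p q. p \<in> dom (ACC ell \<alpha>) \<Longrightarrow> q \<in> the (P (\<Phi> p)) \<Longrightarrow> \<Psi> (p, q) \<in> the (ACC ell \<alpha> p)"
    unfolding reduction_def by (simp_all del: domIff)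
  let ?K = "core ell `` {\<alpha>}"
  have K: "?K \<subseteq> dom (ACC ell \<alpha>)"
    using core_subset_ACC_dom[of ell] by (auto simp: dom_ACC)
  have cont: "continuous_on ?K \<Phi>"
    using continuous_on_subset[OF \<Phi>(1) K] .
  have "\<not> continuous_problem (P |` (\<Phi> ` ?K))"
  proof
    assume "continuous_problem (P |` (\<Phi> ` ?K))"
    then obtain f where "realizes f (P |` (\<Phi> ` ?K))"
      unfolding continuous_problem_iff ..
    moreover have "dom (P |` (\<Phi> ` ?K)) = \<Phi> ` ?K"
      using K \<Phi>(2) by auto
    ultimately have f: "continuous_on (\<Phi> ` ?K) f" "\<And>p. p \<in> ?K \<Longrightarrow> f (\<Phi> p) \<in> the (P (\<Phi> p))"
      unfolding realizes_def by auto
    show False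
    proof (rule core_no_realizer[OF rw])
      have "continuous_on ?K (\<lambda>p. (p, f (\<Phi> p)))"
        by (intro continuous_on_Pair continuous_on_id continuous_on_compose2[OF f(1) cont]) auto
      then show "continuous_on ?K (\<lambda>p. \<Psi> (p, f (\<Phi> p)))"
        by (rule continuous_on_compose2[OF \<Psi>(1)]) (use K f(2) in auto)
      show "ACC_sol ell \<alpha> p (\<Psi> (p, f (\<Phi> p)))" if "p \<in> ?K" for p
        using \<Psi>(2)[of p "f (\<Phi> p)"] that K f(2) by (auto simp: the_ACC)
    qed
  qed
  moreover have "cb_derivative (\<Phi> ` ?K) \<alpha> \<subseteq> {\<Phi> hashes}"
    using cb_derivative_image_compact[OF compact_core[OF rw] cont, of \<alpha>] cb_derivative_core[OF rw]
    by blast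
  then have "cb_rank_le (\<Phi> ` ?K) \<alpha>"
    unfolding cb_rank_le_def by (rule derived_subsingleton)
  ultimately show ?thesis
    by blast
qed

section \<open>Where discontinuity is located\<close>

text \<open>
  Restricting the instances can lower the ranks, while restricting the solutions makes it harder to be
  continuous. The induction over ranks passes from a problem to subproblems of this kind.
\<close>

definition subproblem :: "problem \<Rightarrow> baire set \<Rightarrow> baire set \<Rightarrow> problem" where
  "subproblem R C S = (\<lambda>x. if x \<in> C then map_option (\<lambda>Y. Y \<inter> S) (R x) else None)"

lemma dom_subproblem: "dom (subproblem R C S) = dom R \<inter> C"
  by (auto simp: subproblem_def dom_def)

lemma the_subproblem: "x \<in> dom R \<inter> C \<Longrightarrow> the (subproblem R C S x) = the (R x) \<inter> S"
  by (auto simp: subproblem_def)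

lemma subproblem_subproblem:
  "subproblem (subproblem R C S) C' UNIV = subproblem R (C \<inter> C') S"
  by (auto simp: subproblem_def fun_eq_iff option.map_ident)

lemma realizes_subproblem:
  "realizes f (subproblem R C S) \<longleftrightarrow>
    continuous_on (dom R \<inter> C) f \<and> (\<forall>x \<in> dom R \<inter> C. f x \<in> the (R x) \<inter> S)"
  unfolding realizes_def dom_subproblem by (simp add: the_subproblem)

text \<open>
  If every instance had a cylinder with a realizer, choosing at each instance the largest such
  cylinder would partition the domain into clopen pieces. The realizers on the pieces form a
  realizer on the whole domain.
\<close>

lemma discontinuous_at_point:
  assumes "\<not> continuous_problem R"
  shows "\<exists>p \<in> dom R. \<forall>k. \<not> continuous_problem (subproblem R (cyl p k) UNIV)"
proof (rule ccontr)
  let ?Q = "\<lambda>x k. continuous_problem (subproblem R (cyl x k) UNIV)"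
  assume "\<not> ?thesis"
  then have ex: "\<exists>k. ?Q x k" if "x \<in> dom R" for x
    using that by blast
  define K where "K x = (LEAST k. ?Q x k)" for x
  \<comment> \<open>The realizer is chosen from the cylinder alone, so that all its points use the same one.\<close>
  define F where "F C = (SOME f. realizes f (subproblem R C UNIV))" for C
  define f where "f x = F (cyl x (K x)) x" for x
  have K: "?Q x (K x)" if "x \<in> dom R" for x
    unfolding K_def using ex[OF that] by (rule LeastI_ex)
  have F: "realizes (F (cyl x (K x))) (subproblem R (cyl x (K x)) UNIV)" if "x \<in> dom R" for x
    using K[OF that] unfolding continuous_problem_iff F_def by (rule someI_ex)
  have eq: "K y = K x" if x: "x \<in> dom R" and y: "y \<in> dom R" "y \<in> cyl x (K x)" for x y
  proof (rule antisym)
    have "?Q y (K x)"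
      using K[OF x] cyl_eq[OF y(2)] by simp
    then show le: "K y \<le> K x"
      unfolding K_def[of y] by (rule Least_le)
    have "cyl y (K y) = cyl x (K y)"
      using y(2) cyl_antimono[OF le] by (intro cyl_eq) auto
    then have "?Q x (K y)"
      using K[OF y(1)] by simp
    then show "K x \<le> K y"
      unfolding K_def[of x] by (rule Least_le)
  qed
  have "continuous_on (dom R) f"
    unfolding continuous_on_cyl
  proof (intro ballI allI)
    fix x k assume x: "x \<in> dom R"
    have "continuous_on (dom R \<inter> cyl x (K x)) (F (cyl x (K x)))"
      using F[OF x] by (simp add: realizes_subproblem)
    then obtain l where l: "\<forall>y \<in> dom R \<inter> cyl x (K x) \<inter> cyl x l.
        F (cyl x (K x)) y \<in> cyl (F (cyl x (K x)) x) k"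
      unfolding continuous_on_cyl using x cyl_self by blast
    have "f y \<in> cyl (f x) k" if y: "y \<in> dom R" "y \<in> cyl x (max (K x) l)" for y
    proof -
      have yx: "y \<in> cyl x (K x)" "y \<in> cyl x l"
        using y(2) by (simp_all add: cyl_max)
      have "f y = F (cyl x (K x)) y"
        using eq[OF x y(1) yx(1)] cyl_eq[OF yx(1)] by (simp add: f_def)
      then show ?thesis
        using l y(1) yx by (simp add: f_def)
    qed
    then show "\<exists>l. \<forall>y \<in> dom R \<inter> cyl x l. f y \<in> cyl (f x) k"
      by (intro exI[of _ "max (K x) l"]) simp
  qed
  moreover have "\<forall>x \<in> dom R. f x \<in> the (R x)"
    using F by (auto simp: f_def realizes_subproblem)
  ultimately show False
    using assms unfolding continuous_problem_iff realizes_def by blast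
qed

text \<open>
  Stages that become ready eventually can be entered so slowly that each one is ready when it is
  entered and every stage is nevertheless passed in the end.
\<close>

lemma slow_stages:
  fixes ready :: "nat \<Rightarrow> nat \<Rightarrow> bool"
  assumes "\<And>j. ready 0 j" and "\<And>k. \<exists>J. \<forall>j\<ge>J. ready k j"
  obtains t where "\<And>j. ready (t j) j" "\<And>k. \<exists>J. \<forall>j\<ge>J. k \<le> t j"
proof
  let ?T = "\<lambda>j. {k. k \<le> j \<and> ready k j}"
  have fin: "finite (?T j)" for j
    by simp
  show "ready (Max (?T j)) j" for j
    using Max_in[OF fin, of j] assms(1) by blast
  show "\<exists>J. \<forall>j\<ge>J. k \<le> Max (?T j)" for k
  proof -
    obtain J where J: "\<forall>j\<ge>J. ready k j"
      using assms(2) by blast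
    then have "\<forall>j\<ge>max k J. k \<le> Max (?T j)"
      using Max_ge[OF fin] by simp
    then show ?thesis ..
  qed
qed

definition first_diff :: "baire \<Rightarrow> baire \<Rightarrow> nat" where
  "first_diff p x = (LEAST i. x i \<noteq> p i)"

lemma first_diff_neq: "x \<noteq> p \<Longrightarrow> x (first_diff p x) \<noteq> p (first_diff p x)"
  unfolding first_diff_def by (rule LeastI_ex) auto

lemma mem_cyl_iff_first_diff:
  assumes "x \<noteq> p"
  shows "x \<in> cyl p k \<longleftrightarrow> k \<le> first_diff p x"
proof
  show "k \<le> first_diff p x" if "x \<in> cyl p k"
    using that first_diff_neq[OF assms] by (auto simp: cyl_def not_less[symmetric])
  show "x \<in> cyl p k" if "k \<le> first_diff p x"
  proof -
    have "x i = p i" if "i < first_diff p x" for i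
      using not_less_Least[of i "\<lambda>i. x i \<noteq> p i"] that by (simp add: first_diff_def)
    then show ?thesis
      using that by (simp add: cyl_def)
  qed
qed

lemma first_diff_locally_constant:
  assumes x: "x \<noteq> p" and y: "y \<in> cyl x (Suc (first_diff p x))"
  shows "y \<noteq> p" and "first_diff p y = first_diff p x"
proof -
  have eq: "y i = x i" if "i \<le> first_diff p x" for i
    using y that by (simp add: cyl_def)
  then have neq: "y (first_diff p x) \<noteq> p (first_diff p x)"
    using first_diff_neq[OF x] by simp
  then show "y \<noteq> p"
    by auto
  show "first_diff p y = first_diff p x"
    unfolding first_diff_def[of p y]
  proof (rule Least_equality)
    show "y (first_diff p x) \<noteq> p (first_diff p x)"
      by (rule neq)
    show "first_diff p x \<le> i" if "y i \<noteq> p i" for i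
    proof (rule ccontr)
      assume "\<not> first_diff p x \<le> i"
      then have "x i \<noteq> p i"
        using that eq by simp
      then show False
        using \<open>\<not> first_diff p x \<le> i\<close> Least_le[of "\<lambda>i. x i \<noteq> p i" i] by (simp add: first_diff_def)
    qed
  qed
qed

text \<open>
  Suppose that for every \<open>K\<close> there is a neighbourhood of \<open>p\<close> on which, away from \<open>p\<close>, a continuous
  \<open>f K\<close> finds solutions agreeing with \<open>q\<close> on the first \<open>K\<close> positions. Using \<open>f K\<close> with \<open>K\<close> growing
  slowly as the argument approaches \<open>p\<close> gives a realizer near \<open>p\<close> with the value \<open>q\<close> at \<open>p\<close>.
\<close>

lemma discontinuous_near_solution:
  assumes p: "p \<in> dom R" and q: "q \<in> the (R p)"
    and dis: "\<And>k. \<not> continuous_problem (subproblem R (cyl p k) UNIV)"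
  shows "\<exists>K. \<forall>k. \<not> continuous_problem (subproblem R (cyl p k - {p}) (cyl q K))"
proof (rule ccontr)
  assume "\<not> ?thesis"
  then have "\<forall>K. \<exists>k f. realizes f (subproblem R (cyl p k - {p}) (cyl q K))"
    unfolding continuous_problem_iff by blast
  then obtain \<kappa> f where f: "\<And>K. realizes (f K) (subproblem R (cyl p (\<kappa> K) - {p}) (cyl q K))"
    by metis
  obtain t where t: "\<And>j. t j = 0 \<or> \<kappa> (t j) \<le> j" and t_lim: "\<And>k. \<exists>J. \<forall>j\<ge>J. k \<le> t j"
    by (rule slow_stages[of "\<lambda>k j. k = 0 \<or> \<kappa> k \<le> j"]) blast+
  define g where "g x = (if x = p then q else f (t (first_diff p x)) x)" for x
  let ?D = "dom R \<inter> cyl p (\<kappa> 0)"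
  have dom: "x \<in> dom R \<inter> (cyl p (\<kappa> (t (first_diff p x))) - {p})" if "x \<in> ?D" "x \<noteq> p" for x
    using that t[of "first_diff p x"] by (auto simp: mem_cyl_iff_first_diff)
  have sol: "g x \<in> the (R x) \<and> g x \<in> cyl q (t (first_diff p x))" if "x \<in> ?D" "x \<noteq> p" for x
    using f[of "t (first_diff p x)"] dom[OF that] that(2) by (simp add: g_def realizes_subproblem)
  have "continuous_on ?D g"
    unfolding continuous_on_cyl
  proof (intro ballI allI)
    fix x k assume x: "x \<in> ?D"
    show "\<exists>l. \<forall>y \<in> ?D \<inter> cyl x l. g y \<in> cyl (g x) k"
    proof (cases "x = p")
      case True
      obtain J where J: "\<forall>j\<ge>J. k \<le> t j"
        using t_lim by blast
      have "g y \<in> cyl (g x) k" if y: "y \<in> ?D" "y \<in> cyl p J" for y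
      proof (cases "y = p")
        case False
        then have "k \<le> t (first_diff p y)"
          using J y(2) by (simp add: mem_cyl_iff_first_diff)
        then show ?thesis
          using sol[OF y(1) False] cyl_antimono[of k "t (first_diff p y)" q] True
          by (auto simp: g_def[of p])
      qed (simp add: True)
      then show ?thesis
        using True by (intro exI[of _ J]) simp
    next
      case False
      \<comment> \<open>Away from \<open>p\<close> the stage is locally constant, so \<open>g\<close> is locally one of the realizers.\<close>
      let ?f = "f (t (first_diff p x))"
      let ?D' = "dom R \<inter> (cyl p (\<kappa> (t (first_diff p x))) - {p})"
      have "continuous_on ?D' ?f"
        using f[of "t (first_diff p x)"] by (simp add: realizes_subproblem)
      then obtain l where l: "\<forall>y \<in> ?D' \<inter> cyl x l. ?f y \<in> cyl (?f x) k"
        unfolding continuous_on_cyl using dom[OF x False] by blast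
      have "g y \<in> cyl (g x) k" if y: "y \<in> ?D" "y \<in> cyl x (max (Suc (first_diff p x)) l)" for y
      proof -
        have yx: "y \<in> cyl x (Suc (first_diff p x))" "y \<in> cyl x l"
          using y(2) by (simp_all add: cyl_max)
        note loc = first_diff_locally_constant[OF False yx(1)]
        show ?thesis
          using l dom[OF y(1) loc(1)] yx(2) loc False by (simp add: g_def)
      qed
      then show ?thesis
        by (intro exI[of _ "max (Suc (first_diff p x)) l"]) simp
    qed
  qed
  moreover have "g x \<in> the (R x)" if "x \<in> ?D" for x
    using sol[OF that] q by (cases "x = p") (simp_all add: g_def)
  ultimately have "realizes g (subproblem R (cyl p (\<kappa> 0)) UNIV)"
    by (simp add: realizes_subproblem)
  then show False
    using dis continuous_problem_iff by blast
qed

lemma has_cb_rank_isolated: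
  assumes "has_cb_rank A p \<delta>"
  obtains k where "cb_derivative A \<delta> \<inter> cyl p k \<subseteq> {p}"
proof -
  have "\<not> p islimpt cb_derivative A \<delta>"
    using assms by (simp add: has_cb_rank_def derived_def)
  then show thesis
    using that unfolding islimpt_cyl by blast
qed

text \<open>
  With \<open>p\<close> removed, a small neighbourhood of \<open>p\<close> contains only points whose rank is below that of
  \<open>p\<close>. The discontinuity given by \<open>discontinuous_near_solution\<close> occurs at such a point \<open>x\<close>, and the
  ranks in a small neighbourhood \<open>C\<close> of \<open>x\<close> are bounded by the rank of \<open>x\<close>.
\<close>

lemma discontinuous_at_smaller_rank:
  fixes \<beta> :: "'o::wellorder"
  assumes rank: "cb_rank_le (dom R) \<beta>" and p: "p \<in> dom R" and q: "q \<in> the (R p)"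
    and dis: "\<And>k. \<not> continuous_problem (subproblem R (cyl p k) UNIV)"
  shows "\<exists>K. \<forall>k. \<exists>C \<gamma>. \<gamma> < \<beta> \<and> C \<subseteq> cyl p k \<and> cb_rank_le (dom R \<inter> C) \<gamma> \<and>
    \<not> continuous_problem (subproblem R C (cyl q K))"
proof -
  let ?A = "dom R"
  have ranked: "\<exists>\<delta>\<le>\<beta>. has_cb_rank ?A x \<delta>" if "x \<in> ?A" for x
    using rank that unfolding cb_rank_le_iff by blast
  obtain \<delta> where \<delta>: "\<delta> \<le> \<beta>" "has_cb_rank ?A p \<delta>"
    using ranked[OF p] by blast
  obtain k\<^sub>0 where k\<^sub>0: "cb_derivative ?A \<delta> \<inter> cyl p k\<^sub>0 \<subseteq> {p}"
    using has_cb_rank_isolated[OF \<delta>(2)] .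
  obtain K where K: "\<forall>k. \<not> continuous_problem (subproblem R (cyl p k - {p}) (cyl q K))"
    using discontinuous_near_solution[OF p q dis] ..
  have "\<exists>C \<gamma>. \<gamma> < \<beta> \<and> C \<subseteq> cyl p k \<and> cb_rank_le (?A \<inter> C) \<gamma> \<and>
    \<not> continuous_problem (subproblem R C (cyl q K))" for k
  proof -
    let ?U = "cyl p (max k k\<^sub>0) - {p}"
    obtain x where x: "x \<in> ?A \<inter> ?U"
      and dis_x: "\<And>i. \<not> continuous_problem (subproblem R (?U \<inter> cyl x i) (cyl q K))"
      using discontinuous_at_point[OF spec[OF K, of "max k k\<^sub>0"]]
      unfolding dom_subproblem subproblem_subproblem by blast
    obtain \<gamma> :: 'o where \<gamma>: "has_cb_rank ?A x \<gamma>"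
      using ranked[of x] x by blast
    have U: "?U \<subseteq> cyl p k" "?U \<subseteq> cyl p k\<^sub>0"
      by (auto simp: cyl_max)
    have "\<gamma> < \<delta>"
    proof (rule ccontr)
      assume "\<not> \<gamma> < \<delta>"
      then have "x \<in> cb_derivative ?A \<delta>"
        using \<gamma> cb_derivative_antimono[of \<delta> \<gamma> ?A]
        by (auto simp: has_cb_rank_def not_less)
      then show False
        using k\<^sub>0 x U(2) by auto
    qed
    obtain i where i: "cb_derivative ?A \<gamma> \<inter> cyl x i \<subseteq> {x}"
      using has_cb_rank_isolated[OF \<gamma>] .
    have "cb_derivative (?A \<inter> (?U \<inter> cyl x i)) \<gamma> \<subseteq> {x}"
      using cb_derivative_mono[of "?A \<inter> (?U \<inter> cyl x i)" ?A \<gamma>]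
        cb_derivative_subset[of "?A \<inter> (?U \<inter> cyl x i)" \<gamma>] i by blast
    then have "cb_rank_le (?A \<inter> (?U \<inter> cyl x i)) \<gamma>"
      unfolding cb_rank_le_def by (rule derived_subsingleton)
    moreover have "?U \<inter> cyl x i \<subseteq> cyl p k"
      using U(1) by blast
    moreover have "\<gamma> < \<beta>"
      using \<open>\<gamma> < \<delta>\<close> \<delta>(1) by simp
    ultimately show ?thesis
      using dis_x[of i] by (intro exI[of _ "?U \<inter> cyl x i"] exI[of _ \<gamma>] conjI)
  qed
  then show ?thesis
    by blast
qed

section \<open>Assembling the reduction\<close>

lemma first_diff_block: "first_diff hashes (block j n w) = j"
  unfolding first_diff_def by (rule Least_equality) (auto simp: block_nth split: if_splits)

lemma suffix_block: "suffix (Suc j) (block j n w) = w"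
  by (simp add: fun_eq_iff block_nth)

text \<open>
  The parts of a block are determined by it, so functions of instances can be given by their
  values on the two kinds of instances.
\<close>

lemma ex_function_on_blocks:
  "\<exists>F. F hashes = a \<and> (\<forall>j n w. F (block j n w) = b j n w)"
proof -
  define F where "F x = (if x = hashes then a
    else b (first_diff hashes x) (x (first_diff hashes x) - 1) (suffix (Suc (first_diff hashes x)) x))" for x
  have "block j n w j = Suc n" for j n w
    by (simp add: block_nth)
  then have "F (block j n w) = b j n w" for j n w
    using hashes_neq_block[of j n w] by (simp add: F_def first_diff_block suffix_block del: suffix_nth)
  moreover have "F hashes = a"
    by (simp add: F_def)
  ultimately show ?thesis
    by blast
qed

lemma dom_ACC_cases:
  assumes "x \<in> dom (ACC ell \<beta>)"
  obtains "x = hashes" | j n w where "bot < \<beta>" "x = block j n w" "w \<in> dom (ACC ell (ell \<beta> j))"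
proof -
  have "(\<beta>, x) \<in> ACC_dom ell"
    using assms by (simp add: dom_ACC)
  then show thesis
  proof cases
    case (step j w n)
    then show ?thesis
      using that(2)[of j n w] by (simp only: block_def dom_ACC mem_Collect_eq)
  qed (rule that(1))
qed

lemma block_in_dom_ACC:
  assumes "block j n w \<in> dom (ACC ell \<beta>)"
  shows "w \<in> dom (ACC ell (ell \<beta> j))"
  using assms
proof (cases rule: dom_ACC_cases)
  case 1
  then show ?thesis
    using hashes_neq_block by metis
next
  case (2 j' n' w')
  then show ?thesis
    unfolding block_inject by (elim conjE) (simp only:)
qed

lemma near_hashes_in_dom_ACC:
  assumes "x \<in> dom (ACC ell \<beta>)" and "x \<in> cyl hashes k"
  obtains "x = hashes" | j n w where "k \<le> j" "x = block j n w" "w \<in> dom (ACC ell (ell \<beta> j))"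
  using assms(1)
proof (cases rule: dom_ACC_cases)
  case (2 j n w)
  then show ?thesis
    using that(2) assms(2) by (simp add: block_mem_cyl_hashes)
qed (rule that(1))

lemma near_block_in_dom_ACC:
  assumes "x \<in> dom (ACC ell \<beta>)" and "x \<in> cyl (block j n w) (Suc j + k)"
  obtains w' where "x = block j n w'" "w' \<in> cyl w k" "w' \<in> dom (ACC ell (ell \<beta> j))"
  using assms block_in_dom_ACC unfolding cyl_block by blast

lemma eventually_same_cylinders:
  fixes M :: nat
  shows "\<exists>L. \<forall>q' \<in> cyl q L. \<forall>m < M. q' \<in> cyl (c m) (K m) \<longleftrightarrow> q \<in> cyl (c m) (K m)"
proof (intro exI ballI allI impI)
  fix q' m assume q': "q' \<in> cyl q (\<Sum>m<M. K m)" and "m < M"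
  then have "K m \<le> (\<Sum>m<M. K m)"
    by (intro member_le_sum) auto
  then have "q' \<in> cyl q (K m)"
    using q' cyl_antimono by blast
  then show "q' \<in> cyl (c m) (K m) \<longleftrightarrow> q \<in> cyl (c m) (K m)"
    by (auto simp: cyl_def)
qed

lemma prefix_mem_cyl: "y \<in> cyl z k \<Longrightarrow> u \<frown> y \<in> cyl (u \<frown> z) k"
  by (auto simp: cyl_def conc_def)

lemma num_hashes_mem_cyl:
  assumes "k \<le> j"
  shows "([num n] @ replicate j hash) \<frown> z \<in> cyl ([num n] \<frown> hashes) k"
proof -
  have "(([num n] @ replicate j hash) \<frown> z) i = ([num n] \<frown> hashes) i" if "i < k" for i
    using that assms by (cases i) (auto simp: conc_def)
  then show ?thesis
    unfolding cyl_def by blast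
qed

text \<open>
  The forward function sends \<open>#\<^sup>\<omega>\<close> to \<open>p\<close>. On \<open>#\<^sup>j n w\<close> it uses the reduction to the subproblem for
  \<open>n\<close> and \<open>j\<close> if \<open>n < t j\<close>, and stays at \<open>p\<close> otherwise; it is continuous at \<open>#\<^sup>\<omega>\<close> since \<open>t j\<close> tends to
  infinity.

  The backward function looks for an \<open>m\<close> such that the given solution \<open>q\<close> lies in \<open>S m\<close>, and answers
  \<open>m\<close>. On \<open>#\<^sup>j n w\<close> it examines only \<open>m < t j\<close>, because the search must be a decision about finitely
  many positions of \<open>q\<close>; if it finds nothing, the answer \<open>n + 1\<close> is safe, as it differs from
  \<open>n\<close>. If it finds \<open>n\<close> itself, then \<open>n < t j\<close> and \<open>q\<close> is in \<open>S n\<close>, so \<open>q\<close> solves the subproblem, and the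
  reduction for \<open>n\<close> and \<open>j\<close> turns \<open>q\<close> into a solution of \<open>w\<close>. Writing \<open>j\<close> hashes before that solution
  keeps the answer close to \<open>m #\<^sup>\<omega>\<close>, the answer at \<open>#\<^sup>\<omega>\<close>.
\<close>

lemma ACC_le_assemble:
  fixes R :: problem and S :: "nat \<Rightarrow> baire set" and t :: "nat \<Rightarrow> nat"
  assumes \<beta>: "bot < \<beta>" and p: "p \<in> dom R"
    and S: "\<And>n. S n = cyl (c n) (K n)" and cover: "the (R p) \<subseteq> (\<Union>n. S n)"
    and t: "\<And>k. \<exists>J. \<forall>j\<ge>J. k \<le> t j"
    and near: "\<And>n j. n < t j \<Longrightarrow> C n j \<subseteq> cyl p (t j)"
    and red: "\<And>n j. n < t j \<Longrightarrow> ACC ell (ell \<beta> j) \<le>\<^sub>W subproblem R (C n j) (S n)"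
  shows "ACC ell \<beta> \<le>\<^sub>W R"
proof -
  let ?A = "\<lambda>j. ACC ell (ell \<beta> j)" and ?R = "\<lambda>n j. subproblem R (C n j) (S n)"
  have "\<forall>n j. \<exists>F G. n < t j \<longrightarrow> reduction F G (?A j) (?R n j)"
    using red unfolding cont_weihrauch_le_iff by blast
  then obtain F G where FG: "\<And>n j. n < t j \<Longrightarrow> reduction (F n j) (G n j) (?A j) (?R n j)"
    by metis
  have F: "continuous_on (dom (?A j)) (F n j)"
      "w \<in> dom (?A j) \<Longrightarrow> F n j w \<in> dom (?R n j)"
    and G: "continuous_on {(w, q). w \<in> dom (?A j) \<and> q \<in> the (?R n j (F n j w))} (G n j)"
      "w \<in> dom (?A j) \<Longrightarrow> q \<in> the (?R n j (F n j w)) \<Longrightarrow> G n j (w, q) \<in> the (?A j w)"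
    if "n < t j" for n j w q
    using FG[OF that] unfolding reduction_def by (simp_all del: domIff)
  obtain \<Phi> where \<Phi>: "\<Phi> hashes = p \<and>
      (\<forall>j n w. \<Phi> (block j n w) = (if n < t j then F n j w else p))"
    using ex_function_on_blocks[of p "\<lambda>j n w. if n < t j then F n j w else p"] ..
  note \<Phi>_hashes = conjunct1[OF \<Phi>] and \<Phi>_block = conjunct2[OF \<Phi>, rule_format]
  define first where "first q = (LEAST m. q \<in> S m)" for q
  define guess where "guess j n q =
    (if \<exists>m. m < t j \<and> q \<in> S m then LEAST m. m < t j \<and> q \<in> S m else Suc n)" for j n q
  obtain \<Psi> where \<Psi>: "\<Psi> hashes = (\<lambda>q. [num (first q)] \<frown> hashes) \<and>
      (\<forall>j n w. \<Psi> (block j n w) =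
        (\<lambda>q. if guess j n q = n then ([num n] @ replicate j hash) \<frown> G n j (w, q)
             else [num (guess j n q)] \<frown> hashes))"
    using ex_function_on_blocks[of "\<lambda>q. [num (first q)] \<frown> hashes"
      "\<lambda>j n w q. if guess j n q = n then ([num n] @ replicate j hash) \<frown> G n j (w, q)
        else [num (guess j n q)] \<frown> hashes"] ..
  note \<Psi>_hashes = conjunct1[OF \<Psi>] and \<Psi>_block = conjunct2[OF \<Psi>, rule_format]
  have F_dom: "F n j w \<in> dom R" "F n j w \<in> cyl p (t j)" "F n j w \<in> dom R \<inter> C n j"
    if "n < t j" "w \<in> dom (?A j)" for n j w
    using F(2)[OF that] near[OF that(1)] unfolding dom_subproblem by auto
  have guess_own: "n < t j \<and> q \<in> S n" if "guess j n q = n" for j n q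
  proof -
    have ex: "\<exists>m. m < t j \<and> q \<in> S m"
      using that by (auto simp: guess_def split: if_splits)
    then show ?thesis
      using LeastI_ex[OF ex] that by (simp add: guess_def)
  qed
  have first_in: "q \<in> S (first q)" if "q \<in> the (R p)" for q
    unfolding first_def by (rule LeastI_ex) (use that cover in auto)
  have guess_first: "guess j n q = first q" if "q \<in> S (first q)" "first q < t j" for j n q
  proof -
    have "(LEAST m. m < t j \<and> q \<in> S m) = first q"
      by (rule Least_equality) (use that in \<open>auto simp: first_def intro: Least_le\<close>)
    then show ?thesis
      using that by (auto simp: guess_def)
  qed
  have same: "\<exists>L. \<forall>q' \<in> cyl q L. \<forall>m < M. q' \<in> S m \<longleftrightarrow> q \<in> S m" for q M
    unfolding S by (rule eventually_same_cylinders)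
  have "reduction \<Phi> (\<lambda>(x, q). \<Psi> x q) (ACC ell \<beta>) R"
    unfolding reduction_def
  proof (intro conjI ballI)
    show "\<Phi> x \<in> dom R" if "x \<in> dom (ACC ell \<beta>)" for x
      using that by (cases rule: dom_ACC_cases) (auto simp: \<Phi>_hashes \<Phi>_block F_dom(1) p simp del: domIff)
  next
    show "continuous_on (dom (ACC ell \<beta>)) \<Phi>"
      unfolding continuous_on_cyl
    proof (intro ballI allI)
      fix x k assume x: "x \<in> dom (ACC ell \<beta>)"
      from x show "\<exists>l. \<forall>y \<in> dom (ACC ell \<beta>) \<inter> cyl x l. \<Phi> y \<in> cyl (\<Phi> x) k"
      proof (cases rule: dom_ACC_cases)
        case 1
        obtain J where J: "\<forall>j\<ge>J. k \<le> t j"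
          using t by blast
        have "\<Phi> y \<in> cyl p k" if y: "y \<in> dom (ACC ell \<beta>)" "y \<in> cyl hashes J" for y
          using y
        proof (cases rule: near_hashes_in_dom_ACC)
          case (2 j n w)
          then show ?thesis
            using F_dom(2)[of n j w] cyl_antimono[of k "t j" p] J by (auto simp: \<Phi>_block)
        qed (simp add: \<Phi>_hashes)
        then show ?thesis
          using 1 \<Phi>_hashes by (intro exI[of _ J]) auto
      next
        case (2 j n w)
        obtain l where l: "n < t j \<longrightarrow> (\<forall>v \<in> dom (?A j) \<inter> cyl w l. F n j v \<in> cyl (F n j w) k)"
          using F(1)[of n j] 2(3) unfolding continuous_on_cyl by blast
        have "\<Phi> y \<in> cyl (\<Phi> x) k"
          if y: "y \<in> dom (ACC ell \<beta>)" "y \<in> cyl (block j n w) (Suc j + l)" for y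
          using y by (cases rule: near_block_in_dom_ACC) (use l 2(2) in \<open>simp add: \<Phi>_block\<close>)
        then show ?thesis
          using 2(2) by (intro exI[of _ "Suc j + l"]) auto
      qed
    qed
  next
    show "(case (x, q) of (x, q) \<Rightarrow> \<Psi> x q) \<in> the (ACC ell \<beta> x)"
      if x: "x \<in> dom (ACC ell \<beta>)" and q: "q \<in> the (R (\<Phi> x))" for x q
    proof -
      from x have "ACC_sol ell \<beta> x (\<Psi> x q)"
      proof (cases rule: dom_ACC_cases)
        case 1
        then show ?thesis
          using ACC_sol.hashes[OF \<beta>] by (simp add: \<Psi>_hashes)
      next
        case (2 j n w)
        have w: "(ell \<beta> j, w) \<in> ACC_dom ell"
          using 2(3) by (simp add: dom_ACC)
        show ?thesis
        proof (cases "guess j n q = n")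
          case True
          note own = guess_own[OF True]
          have "q \<in> the (?R n j (F n j w))"
            using own q 2 F_dom(3)[of n j w] by (simp add: \<Phi>_block the_subproblem)
          then have "ACC_sol ell (ell \<beta> j) w (G n j (w, q))"
            using G(2)[of n j w q] own 2(3) the_ACC[OF 2(3)] by simp
          then show ?thesis
            using ACC_sol.step[OF \<beta> w] True
            unfolding 2(2) \<Psi>_block block_def[symmetric] by simp
        next
          case False
          then show ?thesis
            using ACC_sol.avoid[OF \<beta> w, of "guess j n q" n]
            unfolding 2(2) \<Psi>_block block_def[symmetric] by simp
        qed
      qed
      then show ?thesis
        using the_ACC[OF x] by simp
    qed
  next
    let ?E = "{(x, q). x \<in> dom (ACC ell \<beta>) \<and> q \<in> the (R (\<Phi> x))}"
    show "continuous_on ?E (\<lambda>(x, q). \<Psi> x q)"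
      unfolding continuous_on_pair_cyl
    proof (intro allI impI)
      fix x q k assume "(x, q) \<in> ?E"
      then have x: "x \<in> dom (ACC ell \<beta>)" and q: "q \<in> the (R (\<Phi> x))"
        by auto
      have "\<exists>l. \<forall>x' q'. (x', q') \<in> ?E \<longrightarrow> x' \<in> cyl x l \<longrightarrow> q' \<in> cyl q l \<longrightarrow>
          \<Psi> x' q' \<in> cyl (\<Psi> x q) k"
        using x
      proof (cases rule: dom_ACC_cases)
        case 1
        \<comment> \<open>Near \<open>#\<^sup>\<omega>\<close> the bounded search has come as far as \<open>m\<close>, the answer at \<open>#\<^sup>\<omega>\<close>, and finds the same.\<close>
        define m where "m = first q"
        have m: "q \<in> S m"
          using first_in q 1 by (simp add: \<Phi>_hashes m_def)
        obtain L where L: "\<forall>q' \<in> cyl q L. \<forall>i < Suc m. q' \<in> S i \<longleftrightarrow> q \<in> S i"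
          using same by blast
        obtain J where J: "\<forall>j\<ge>J. Suc m \<le> t j"
          using t by blast
        define l where "l = max L (max J k)"
        have "\<Psi> x' q' \<in> cyl (\<Psi> x q) k"
          if E: "(x', q') \<in> ?E" and x': "x' \<in> cyl x l" and q': "q' \<in> cyl q l" for x' q'
        proof -
          have q'L: "q' \<in> cyl q L"
            using q' by (simp add: l_def cyl_max)
          have S_eq: "q' \<in> S i \<longleftrightarrow> q \<in> S i" if "i \<le> m" for i
            using L[rule_format, OF q'L, of i] that by simp
          have first: "first q' = m"
            unfolding first_def
          proof (rule Least_equality)
            show "q' \<in> S m"
              using S_eq[of m] m by simp
            show "m \<le> i" if "q' \<in> S i" for i
            proof (rule ccontr)
              assume "\<not> m \<le> i"
              then have "q \<in> S i"
                using that S_eq[of i] by simp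
              then show False
                using \<open>\<not> m \<le> i\<close> Least_le[of "\<lambda>i. q \<in> S i" i] by (simp add: m_def first_def)
            qed
          qed
          have \<Psi>x: "\<Psi> x q = [num m] \<frown> hashes"
            using 1 by (simp add: \<Psi>_hashes m_def)
          have "x' \<in> dom (ACC ell \<beta>)"
            using E by simp
          moreover have "x' \<in> cyl hashes l"
            using x' 1 by simp
          ultimately show ?thesis
          proof (cases rule: near_hashes_in_dom_ACC)
            case 1
            then show ?thesis
              by (simp add: \<Psi>x \<Psi>_hashes first)
          next
            case (2 j n w)
            have "guess j n q' = m"
              using guess_first[of q' j n] first S_eq[of m] m J 2(1) by (auto simp: l_def)
            moreover have "k \<le> j"
              using 2(1) by (simp add: l_def)
            ultimately show ?thesis
              using num_hashes_mem_cyl[of k j n "G n j (w, q')"]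
              unfolding 2(2) \<Psi>x \<Psi>_block by auto
          qed
        qed
        then show ?thesis
          by blast
      next
        case (2 j n w)
        obtain L where L: "\<forall>q' \<in> cyl q L. \<forall>i < t j. q' \<in> S i \<longleftrightarrow> q \<in> S i"
          using same by blast
        \<comment> \<open>With \<open>j\<close> fixed, the bounded search depends on a finite prefix of \<open>q\<close>.\<close>
        have guess_eq: "guess j n q' = guess j n q" if "q' \<in> cyl q L" for q'
        proof -
          have "(i < t j \<and> q' \<in> S i) \<longleftrightarrow> (i < t j \<and> q \<in> S i)" for i
            using L that by blast
          then show ?thesis
            by (simp only: guess_def)
        qed
        let ?E' = "{(w, q). w \<in> dom (?A j) \<and> q \<in> the (?R n j (F n j w))}"
        have in_E': "(v, q') \<in> ?E'"
          if "v \<in> dom (?A j)" "q' \<in> the (R (\<Phi> (block j n v)))" "guess j n q' = n" for v q'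
          using that guess_own[OF that(3)] F_dom(3)[of n j v] by (simp add: \<Phi>_block the_subproblem)
        have "\<exists>l. guess j n q = n \<longrightarrow> (\<forall>w' q'. (w', q') \<in> ?E' \<and> w' \<in> cyl w l \<and> q' \<in> cyl q l
            \<longrightarrow> G n j (w', q') \<in> cyl (G n j (w, q)) k)"
        proof (cases "guess j n q = n")
          case True
          then have "n < t j" and "(w, q) \<in> ?E'"
            using guess_own in_E'[of w q] 2 q by auto
          then show ?thesis
            using G(1)[of n j] unfolding continuous_on_pair_cyl by blast
        qed simp
        then obtain l where l: "guess j n q = n \<Longrightarrow> (w', q') \<in> ?E' \<Longrightarrow> w' \<in> cyl w l \<Longrightarrow>
            q' \<in> cyl q l \<Longrightarrow> G n j (w', q') \<in> cyl (G n j (w, q)) k" for w' q'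
          by blast
        define l' where "l' = max (max L l) (Suc j + l)"
        have "\<Psi> x' q' \<in> cyl (\<Psi> x q) k"
          if E: "(x', q') \<in> ?E" and x': "x' \<in> cyl x l'" and q': "q' \<in> cyl q l'" for x' q'
        proof -
          have "x' \<in> cyl (block j n w) (Suc j + l)"
            using x' 2(2) by (simp add: l'_def cyl_max)
          moreover have "x' \<in> dom (ACC ell \<beta>)"
            using E by simp
          ultimately obtain v where v: "x' = block j n v" "v \<in> cyl w l" "v \<in> dom (?A j)"
            using near_block_in_dom_ACC by metis
          have q'': "q' \<in> cyl q L" "q' \<in> cyl q l"
            using q' by (simp_all add: l'_def cyl_max)
          note eq = guess_eq[OF q''(1)]
          show ?thesis
          proof (cases "guess j n q = n")
            case True
            have "(v, q') \<in> ?E'"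
              by (rule in_E'[OF v(3)]) (use E v(1) True eq in simp_all)
            then have "G n j (v, q') \<in> cyl (G n j (w, q)) k"
              using l[OF True] v(2) q''(2) by blast
            from prefix_mem_cyl[OF this, of "[num n] @ replicate j hash"] show ?thesis
              using True eq unfolding v(1) 2(2) \<Psi>_block by simp
          next
            case False
            then show ?thesis
              using eq unfolding v(1) 2(2) \<Psi>_block by simp
          qed
        qed
        then show ?thesis
          by blast
      qed
      then show "\<exists>l. \<forall>x' q'. (x', q') \<in> ?E \<and> x' \<in> cyl x l \<and> q' \<in> cyl q l \<longrightarrow>
          (case (x', q') of (x, q) \<Rightarrow> \<Psi> x q) \<in> cyl (case (x, q) of (x, q) \<Rightarrow> \<Psi> x q) k"
        unfolding prod.case by blast
    qed
  qed
  then show ?thesis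
    unfolding cont_weihrauch_le_iff by blast
qed

text \<open>
  The constant map to \<open>p\<close> is a reduction, because no solution ever has to be translated back.
\<close>

lemma ACC_le_if_unsolvable_instance:
  assumes "p \<in> dom R" and "the (R p) = {}"
  shows "ACC ell \<beta> \<le>\<^sub>W R"
  unfolding cont_weihrauch_le_iff reduction_def
  by (intro exI[of _ "\<lambda>_. p"]) (use assms in auto)

lemma countable_cylinder_cover:
  assumes "Q \<noteq> {}"
  obtains c where "range c \<subseteq> Q" "Q \<subseteq> (\<Union>n :: nat. cyl (c n) (K (c n)))"
proof -
  obtain \<F> where \<F>: "\<F> \<subseteq> (\<lambda>q. cyl q (K q)) ` Q" "countable \<F>" "\<Union>\<F> = (\<Union>q\<in>Q. cyl q (K q))"
    using Lindelof[of "(\<lambda>q. cyl q (K q)) ` Q"] open_cyl by blast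
  then obtain Q' where Q': "countable Q'" "Q' \<subseteq> Q" "\<F> = (\<lambda>q. cyl q (K q)) ` Q'"
    using countable_subset_image[of \<F> "\<lambda>q. cyl q (K q)" Q] by metis
  have cov: "Q \<subseteq> (\<Union>q\<in>Q'. cyl q (K q))"
  proof
    fix q assume "q \<in> Q"
    then have "q \<in> (\<Union>q\<in>Q. cyl q (K q))"
      using cyl_self by blast
    then show "q \<in> (\<Union>q\<in>Q'. cyl q (K q))"
      using \<F>(3) Q'(3) by simp
  qed
  then have "Q' \<noteq> {}"
    using assms by auto
  then have r: "range (from_nat_into Q') = Q'"
    using Q'(1) by (rule range_from_nat_into)
  show thesis
  proof (rule that)
    show "range (from_nat_into Q') \<subseteq> Q"
      using r Q'(2) by simp
    show "Q \<subseteq> (\<Union>n. cyl (from_nat_into Q' n) (K (from_nat_into Q' n)))"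
    proof
      fix q assume "q \<in> Q"
      then obtain c where "c \<in> Q'" "q \<in> cyl c (K c)"
        using cov by auto
      moreover obtain n where "c = from_nat_into Q' n"
        using r \<open>c \<in> Q'\<close> by (metis rangeE)
      ultimately show "q \<in> (\<Union>n. cyl (from_nat_into Q' n) (K (from_nat_into Q' n)))"
        by auto
    qed
  qed
qed

text \<open>
  The orders \<open>\<gamma> n k\<close> at which the subproblems are discontinuous depend on the prefix with index \<open>n\<close>
  and on the required closeness \<open>k\<close> to \<open>p\<close>, whereas the instance \<open>#\<^sup>j n w\<close> demands the order \<open>ell \<beta> j\<close>.
  Since \<open>ell \<beta>\<close> is cofinal, the closeness can grow with \<open>j\<close> so slowly that the finitely many relevant
  orders \<open>\<gamma> n (t j)\<close> with \<open>n < t j\<close> stay below \<open>ell \<beta> j\<close>.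
\<close>

theorem ACC_le_if_discontinuous:
  fixes \<beta> :: "'o::{wellorder, order_bot}"
  assumes "rank_witnessing_representation \<beta> ell"
    and "cb_rank_le (dom R) \<beta>" and "\<not> continuous_problem R"
  shows "ACC ell \<beta> \<le>\<^sub>W R"
  using assms
proof (induction \<beta> arbitrary: R rule: less_induct)
  case (less \<beta>)
  obtain p where p: "p \<in> dom R"
    and dis: "\<And>k. \<not> continuous_problem (subproblem R (cyl p k) UNIV)"
    using discontinuous_at_point[OF less.prems(3)] by blast
  show ?case
  proof (cases "the (R p) = {}")
    case True
    then show ?thesis
      using ACC_le_if_unsolvable_instance[OF p] by blast
  next
    case False
    have "\<forall>q \<in> the (R p). \<exists>K. \<forall>k. \<exists>C \<gamma>. \<gamma> < \<beta> \<and> C \<subseteq> cyl p k \<and> cb_rank_le (dom R \<inter> C) \<gamma> \<and>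
        \<not> continuous_problem (subproblem R C (cyl q K))"
      using discontinuous_at_smaller_rank[OF less.prems(2) p _ dis] by blast
    then obtain K where K: "\<forall>q \<in> the (R p). \<forall>k. \<exists>C \<gamma>. \<gamma> < \<beta> \<and> C \<subseteq> cyl p k \<and>
        cb_rank_le (dom R \<inter> C) \<gamma> \<and> \<not> continuous_problem (subproblem R C (cyl q (K q)))"
      by metis
    obtain c where c: "range c \<subseteq> the (R p)" and cover: "the (R p) \<subseteq> (\<Union>n :: nat. cyl (c n) (K (c n)))"
      using countable_cylinder_cover[OF False] .
    let ?S = "\<lambda>n. cyl (c n) (K (c n))"
    have "\<forall>n k. \<exists>C \<gamma>. \<gamma> < \<beta> \<and> C \<subseteq> cyl p k \<and> cb_rank_le (dom R \<inter> C) \<gamma> \<and>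
        \<not> continuous_problem (subproblem R C (?S n))"
      using K c by blast
    then obtain C \<gamma> where C: "\<And>n k. \<gamma> n k < \<beta>" "\<And>n k. C n k \<subseteq> cyl p k"
        "\<And>n k. cb_rank_le (dom R \<inter> C n k) (\<gamma> n k)"
        "\<And>n k. \<not> continuous_problem (subproblem R (C n k) (?S n))"
      by metis
    have \<beta>: "bot < \<beta>"
      using C(1)[of 0 0] le_less_trans[OF bot_least] by blast
    then have rw: "mono (ell \<beta>)" "\<And>\<delta>. \<delta> < \<beta> \<Longrightarrow> \<exists>i. \<delta> \<le> ell \<beta> i"
      using less.prems(1) unfolding rank_witnessing_representation_def rank_witnessing_def by auto
    have ready: "\<exists>J. \<forall>j\<ge>J. \<forall>n<k. \<gamma> n k \<le> ell \<beta> j" for k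
    proof -
      have "\<forall>n. \<exists>i. \<gamma> n k \<le> ell \<beta> i"
        using rw(2)[OF C(1)] by blast
      then obtain i where i: "\<And>n. \<gamma> n k \<le> ell \<beta> (i n)"
        by metis
      have "\<gamma> n k \<le> ell \<beta> j" if "(\<Sum>n<k. i n) \<le> j" "n < k" for n j
      proof -
        have "i n \<le> (\<Sum>n<k. i n)"
          using that(2) by (intro member_le_sum) auto
        then have "ell \<beta> (i n) \<le> ell \<beta> j"
          using that(1) by (intro monoD[OF rw(1)]) simp
        then show ?thesis
          using i[of n] by simp
      qed
      then show ?thesis
        by blast
    qed
    obtain t where t: "\<And>j. \<forall>n<t j. \<gamma> n (t j) \<le> ell \<beta> j" "\<And>k. \<exists>J. \<forall>j\<ge>J. k \<le> t j"
      by (rule slow_stages[of "\<lambda>k j. \<forall>n<k. \<gamma> n k \<le> ell \<beta> j"]) (use ready in auto)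
    show ?thesis
    proof (rule ACC_le_assemble[where S = ?S and c = c and K = "\<lambda>n. K (c n)" and t = t
          and C = "\<lambda>n j. C n (t j)", OF \<beta> p refl cover t(2)])
      show "C n (t j) \<subseteq> cyl p (t j)" for n j
        by (rule C(2))
      show "ACC ell (ell \<beta> j) \<le>\<^sub>W subproblem R (C n (t j)) (?S n)" if n: "n < t j" for n j
      proof (rule less.IH)
        show "ell \<beta> j < \<beta>"
          using rank_witnessing_representation_less[OF less.prems(1) \<beta>] .
        show "rank_witnessing_representation (ell \<beta> j) ell"
          using rank_witnessing_representation_ell[OF less.prems(1) \<beta>] .
        show "cb_rank_le (dom (subproblem R (C n (t j)) (?S n))) (ell \<beta> j)"
          unfolding dom_subproblem using cb_rank_le_mono[OF C(3) order_refl] t(1) n by blast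
      qed (rule C(4))
    qed
  qed
qed

lemma restrict_cont_weihrauch_le:
  assumes "Q \<le>\<^sub>W P |` A"
  shows "Q \<le>\<^sub>W P"
proof -
  obtain \<Phi> \<Psi> where red: "reduction \<Phi> \<Psi> Q (P |` A)"
    using assms unfolding cont_weihrauch_le_iff by blast
  have eq: "(P |` A) (\<Phi> p) = P (\<Phi> p) \<and> \<Phi> p \<in> dom P" if "p \<in> dom Q" for p
  proof -
    have "\<Phi> p \<in> dom P \<inter> A"
      using red that unfolding reduction_def by simp
    then show ?thesis
      by simp
  qed
  then have "{(p, q). p \<in> dom Q \<and> q \<in> the ((P |` A) (\<Phi> p))} =
      {(p, q). p \<in> dom Q \<and> q \<in> the (P (\<Phi> p))}"
    by (intro Collect_cong) (simp add: split_beta cong: conj_cong)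
  then have "reduction \<Phi> \<Psi> Q P"
    using red eq unfolding reduction_def by (simp del: domIff)
  then show ?thesis
    unfolding cont_weihrauch_le_iff by blast
qed

theorem theorem1:
  fixes P :: problem
    and \<alpha> :: "'o::{wellorder, order_bot}"
    and ell :: "'o \<Rightarrow> nat \<Rightarrow> 'o"
  assumes "countable {..<\<alpha>}"
    and "rank_witnessing_representation \<alpha> ell"
  shows "(\<exists>A :: baire set. \<not> continuous_problem (P |` A) \<and>
            (\<forall>p \<in> A. \<exists>\<beta> \<le> \<alpha>. has_cb_rank A p \<beta>))
         \<longleftrightarrow> ACC ell \<alpha> \<le>\<^sub>W P"
  unfolding cb_rank_le_iff[symmetric]
proof
  assume "\<exists>A. \<not> continuous_problem (P |` A) \<and> cb_rank_le A \<alpha>"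
  then obtain A where A: "\<not> continuous_problem (P |` A)" "cb_rank_le A \<alpha>"
    by blast
  have "cb_rank_le (dom (P |` A)) \<alpha>"
    using cb_rank_le_mono[OF A(2)] by simp
  then show "ACC ell \<alpha> \<le>\<^sub>W P"
    using ACC_le_if_discontinuous[OF assms(2) _ A(1)] restrict_cont_weihrauch_le by blast
next
  assume "ACC ell \<alpha> \<le>\<^sub>W P"
  then show "\<exists>A. \<not> continuous_problem (P |` A) \<and> cb_rank_le A \<alpha>"
    by (rule discontinuous_restriction_if_ACC_le[OF assms(2)])
qed

end
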